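(* Let $\eta:\mathcal B\to\mathcal B\otimes\mathcal A$ be a nondegenerate ergodic action of a compact quantum group $G=(\mathcal A,\Delta)$ on a unital $C^*$-algebra, with spectral functor $\overline L$, and let $u$ be an irreducible unitary representation of $G$ with conjugate $\overline u$ defined by a solution $R\in(\iota,\overline u\otimes u)$, $\overline R\in(\iota,u\otimes\overline u)$ of the conjugate equations. Let $\hat R=S_{\overline u,u}^*\circ\overline L_R$, $\hat{\overline R}=S_{u,\overline u}^*\circ\overline L_{\overline R}$, and let $\overline J:\overline L_u\to\overline L_{\overline u}$ be the antilinear invertible map $\overline T\mapsto\overline{J(T)}$, $J(T)(\psi)=T(j^*\psi)^*$. Then $$\hat R=\sum_i\overline J\,\overline{T_i}\otimes\overline{T_i},\qquad \hat{\overline R}=\sum_j\overline J^{-1}\,\overline{S_j}\otimes\overline{S_j},$$ where $(\overline{T_i})$ and $(\overline{S_j})$ are orthonormal bases of $\overline L_u$ and $\overline L_{\overline u}$, respectively. Therefore $$\text{q-mult}(u)=d_{\hat R,\hat{\overline R}}(\overline L_u).$$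
   Context: Compact quantum group (Woronowicz): $G=(\mathcal A,\Delta)$, $\mathcal A$ a unital $C^*$-algebra, $\Delta:\mathcal A\to\mathcal A\otimes\mathcal A$ a coassociative unital $^*$-homomorphism such that $\{(b\otimes I)\Delta(c)\}$ and $\{(I\otimes b)\Delta(c)\}$ each span dense subspaces. A unitary representation $u$ on a finite-dimensional $H_u$ is a linear map $u:H_u\to H_u\otimes\mathcal A$, $u(e_j)=\sum_i e_i\otimes u_{ij}$, with $(u_{ij})$ unitary and $\Delta(u_{ij})=\sum_k u_{ik}\otimes u_{kj}$; arrows $(u,v)$ are linear $T:H_u\to H_v$ with $(T\otimes I)u=vT$; $u\otimes v$ acts on $H_u\otimes H_v$ with coefficients $u_{ij}v_{pq}$; $\iota$ is the trivial representation. Conjugate equations: $(\overline R^*\otimes1_u)(1_u\otimes R)=1_u$, $(R^*\otimes1_{\overline u})(1_{\overline u}\otimes\overline R)=1_{\overline u}$. $j:H_u\to H_{\overline u}$ is the antilinear invertible map with $R=\sum_ije_i\otimes e_i$ (then $\overline R=\sum_kj^{-1}f_k\otimes f_k$), $(e_i)$, $(f_k)$ orthonormal bases of $H_u$, $H_{\overline u}$. The adjoint of an antilinear map satisfies $(j\phi,\psi)=(j^*\psi,\phi)$ (inner products linear in the second variable). Action: unital $^*$-homomorphism $\eta$ with $(\eta\otimes\iota)\eta=(\iota\otimes\Delta)\eta$; nondegenerate if $\eta(\mathcal B)(I\otimes\mathcal A)$ spans a dense subspace; ergodic if $\{b:\eta(b)=b\otimes I\}=\mathbb CI$. Spectral functor: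 $L_u$ is the space of linear $T:H_u\to\mathcal B$ with $\eta T=(T\otimes\iota)u$; $\overline L_u$ is its complex conjugate (finite dimensional) with inner product $(\overline S,\overline T)I=\sum_iS(e_i)T(e_i)^*$; $\overline L_A(\overline T)=\overline{T\circ A^*}$ for $A\in(u,v)$; $S_{u,v}:\overline L_u\otimes\overline L_v\to\overline L_{u\otimes v}$ is the isometry $\overline S\otimes\overline T\mapsto\overline{S\otimes T}$, $(S\otimes T)(\psi\otimes\phi)=S(\psi)T(\phi)$. $\overline L_\iota=\mathbb C$, and $\overline L_R:\overline L_\iota\to\overline L_{\overline u\otimes u}$ is identified with the image of $1$. Quantum multiplicity of the irreducible $u$: $\text{q-mult}(u)^2:=\mathrm{Trace}(\overline J\,\overline J^* )\,\mathrm{Trace}((\overline J\,\overline J^* )^{-1})$. Also $d_{\hat R,\hat{\overline R}}(\overline L_u):=\|\hat R\|\,\|\hat{\overline R}\|$. *)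

theory Defs
  imports "HOL-Analysis.Analysis" "HOL-Library.Function_Algebras"
begin

section \<open>Complex vector spaces\<close>

class scaleC =
  fixes scaleC :: "complex \<Rightarrow> 'a \<Rightarrow> 'a" (infixr "*\<^sub>C" 75)

class complex_vector = ab_group_add + scaleC +
  assumes scaleC_add_right: "a *\<^sub>C (x + y) = a *\<^sub>C x + a *\<^sub>C y"
    and scaleC_add_left: "(a + b) *\<^sub>C x = a *\<^sub>C x + b *\<^sub>C x"
    and scaleC_scaleC: "a *\<^sub>C (b *\<^sub>C x) = (a * b) *\<^sub>C x"
    and scaleC_one: "1 *\<^sub>C x = x"

global_interpretation complex_vector: vector_space "scaleC :: complex \<Rightarrow> 'a \<Rightarrow> 'a::complex_vector"
  defines cdependent = complex_vector.dependent
    and cspan = complex_vector.span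
  by unfold_locales (simp_all add: scaleC_add_right scaleC_add_left scaleC_scaleC scaleC_one)

abbreviation clinear :: "('a::complex_vector \<Rightarrow> 'b::complex_vector) \<Rightarrow> bool"
  where "clinear \<equiv> Vector_Spaces.linear scaleC scaleC"

definition antilinear :: "('a::complex_vector \<Rightarrow> 'b::complex_vector) \<Rightarrow> bool"
  where "antilinear f \<longleftrightarrow>
    (\<forall>x y. f (x + y) = f x + f y) \<and> (\<forall>c x. f (c *\<^sub>C x) = cnj c *\<^sub>C f x)"

instantiation complex :: complex_vector
begin
definition scaleC_complex :: "complex \<Rightarrow> complex \<Rightarrow> complex" where "scaleC_complex = (*)"
instance by standard (simp_all add: scaleC_complex_def algebra_simps)
end

instantiation vec :: (complex_vector, finite) complex_vector
begin
definition scaleC_vec :: "complex \<Rightarrow> ('a, 'b) vec \<Rightarrow> ('a, 'b) vec"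
  where "scaleC_vec c x = (\<chi> i. c *\<^sub>C x $ i)"
instance
  by standard (simp_all add: scaleC_vec_def vec_eq_iff scaleC_add_right scaleC_add_left
    scaleC_scaleC scaleC_one)
end

instantiation "fun" :: (type, complex_vector) complex_vector
begin
definition scaleC_fun :: "complex \<Rightarrow> ('a \<Rightarrow> 'b) \<Rightarrow> 'a \<Rightarrow> 'b"
  where "scaleC_fun c f = (\<lambda>x. c *\<^sub>C f x)"
instance
  by standard (simp_all add: scaleC_fun_def fun_eq_iff scaleC_add_right scaleC_add_left
    scaleC_scaleC scaleC_one)
end

text \<open>The complex conjugate of a vector space; \<open>bar x\<close> is \<open>x\<close> regarded as a vector of it.\<close>

typedef 'v cconj = "UNIV :: 'v set" morphisms unbar bar ..

instantiation cconj :: (complex_vector) complex_vector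
begin
definition zero_cconj :: "'a cconj" where "zero_cconj = bar 0"
definition plus_cconj :: "'a cconj \<Rightarrow> 'a cconj \<Rightarrow> 'a cconj"
  where "plus_cconj x y = bar (unbar x + unbar y)"
definition uminus_cconj :: "'a cconj \<Rightarrow> 'a cconj" where "uminus_cconj x = bar (- unbar x)"
definition minus_cconj :: "'a cconj \<Rightarrow> 'a cconj \<Rightarrow> 'a cconj"
  where "minus_cconj x y = bar (unbar x - unbar y)"
definition scaleC_cconj :: "complex \<Rightarrow> 'a cconj \<Rightarrow> 'a cconj"
  where "scaleC_cconj c x = bar (cnj c *\<^sub>C unbar x)"
instance
  by standard (simp_all add: zero_cconj_def plus_cconj_def uminus_cconj_def minus_cconj_def
    scaleC_cconj_def bar_inverse unbar_inverse scaleC_add_right scaleC_add_left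
    scaleC_scaleC scaleC_one add.assoc, simp_all add: add.commute)
end

section \<open>Inner product spaces and their tensor products\<close>

text \<open>
  A finite-dimensional Hilbert space is given by a linear subspace of a complex vector space
  together with an inner product, linear in the second variable, that is meaningful on that
  subspace only.
\<close>

record 'v hspace =
  hcarrier :: "'v set"
  hinner :: "'v \<Rightarrow> 'v \<Rightarrow> complex"

definition hnorm :: "'v hspace \<Rightarrow> 'v \<Rightarrow> real"
  where "hnorm H x = sqrt (Re (hinner H x x))"

definition orthonormal_basis :: "('v::complex_vector) hspace \<Rightarrow> 'v set \<Rightarrow> bool"
  where "orthonormal_basis H E \<longleftrightarrow>
    finite E \<and> (\<forall>x\<in>E. \<forall>y\<in>E. hinner H x y = (if x = y then 1 else 0)) \<and>
    cspan E = hcarrier H"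

definition htrace :: "('v::complex_vector) hspace \<Rightarrow> ('v \<Rightarrow> 'v) \<Rightarrow> complex"
  where "htrace H X = (\<Sum>x\<in>(SOME E. orthonormal_basis H E). hinner H x (X x))"

definition hadjoint :: "'v hspace \<Rightarrow> 'w hspace \<Rightarrow> ('v \<Rightarrow> 'w) \<Rightarrow> 'w \<Rightarrow> 'v"
  where "hadjoint H K f y = (THE x. x \<in> hcarrier H \<and>
    (\<forall>z\<in>hcarrier H. hinner H x z = hinner K y (f z)))"

definition antilinear_adjoint :: "'v hspace \<Rightarrow> 'w hspace \<Rightarrow> ('v \<Rightarrow> 'w) \<Rightarrow> 'w \<Rightarrow> 'v"
  where "antilinear_adjoint H K f y = (THE x. x \<in> hcarrier H \<and>
    (\<forall>z\<in>hcarrier H. hinner K (f z) y = hinner H x z))"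

text \<open>
  The elementary tensor of \<open>v\<close> and \<open>w\<close> is realised as the form
  \<open>(a, b) \<mapsto> (a, v) (b, w)\<close>, antilinear in \<open>a\<close> and \<open>b\<close>; since the inner products are
  nondegenerate on the carriers, the span of these forms is the algebraic tensor product.
  Linear (or sesquilinear) maps on the tensor product are prescribed on sums of elementary
  tensors, represented by lists of pairs.
\<close>

definition tens :: "'v hspace \<Rightarrow> 'w hspace \<Rightarrow> 'v \<Rightarrow> 'w \<Rightarrow> ('v \<times> 'w \<Rightarrow> complex)"
  where "tens H K v w = (\<lambda>(a, b). if a \<in> hcarrier H \<and> b \<in> hcarrier K
    then hinner H a v * hinner K b w else 0)"

definition tens_repr ::
    "'v hspace \<Rightarrow> 'w hspace \<Rightarrow> ('v \<times> 'w) list \<Rightarrow> ('v \<times> 'w \<Rightarrow> complex) \<Rightarrow> bool"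
  where "tens_repr H K xs x \<longleftrightarrow>
    set xs \<subseteq> hcarrier H \<times> hcarrier K \<and> x = (\<Sum>(v, w)\<leftarrow>xs. tens H K v w)"

definition tens_space :: "'v hspace \<Rightarrow> 'w hspace \<Rightarrow> ('v \<times> 'w \<Rightarrow> complex) hspace"
  where "tens_space H K = \<lparr>
    hcarrier = cspan {tens H K v w | v w. v \<in> hcarrier H \<and> w \<in> hcarrier K},
    hinner = (\<lambda>x y. THE c. \<exists>xs ys. tens_repr H K xs x \<and> tens_repr H K ys y \<and>
      c = (\<Sum>(v, w)\<leftarrow>xs. \<Sum>(v', w')\<leftarrow>ys. hinner H v v' * hinner K w w'))\<rparr>"

definition tens_lift :: "'v hspace \<Rightarrow> 'w hspace \<Rightarrow> ('v \<Rightarrow> 'w \<Rightarrow> 'z::complex_vector)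
    \<Rightarrow> ('v \<times> 'w \<Rightarrow> complex) \<Rightarrow> 'z"
  where "tens_lift H K f x =
    (THE y. \<exists>xs. tens_repr H K xs x \<and> y = (\<Sum>(v, w)\<leftarrow>xs. f v w))"

subsection \<open>Coordinate spaces\<close>

definition Cn :: "(complex ^ 'n) hspace"
  where "Cn = \<lparr>hcarrier = UNIV, hinner = (\<lambda>x y. \<Sum>i\<in>UNIV. cnj (x $ i) * y $ i)\<rparr>"

abbreviation stdb :: "'n \<Rightarrow> complex ^ 'n" where "stdb i \<equiv> axis i 1"

text \<open>
  The Hilbert space tensor product of \<open>complex ^ 'n\<close> and \<open>complex ^ 'm\<close> is
  \<open>complex ^ ('n \<times> 'm)\<close>.
\<close>

definition vtens :: "complex ^ 'n \<Rightarrow> complex ^ 'm \<Rightarrow> complex ^ ('n \<times> 'm)"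
  where "vtens x y = (\<chi> p. case p of (i, k) \<Rightarrow> x $ i * y $ k)"

definition map_tens :: "(complex ^ 'n \<Rightarrow> complex ^ 'p) \<Rightarrow> (complex ^ 'm \<Rightarrow> complex ^ 'q)
    \<Rightarrow> complex ^ ('n \<times> 'm) \<Rightarrow> complex ^ ('p \<times> 'q)"
  where "map_tens A B x = (\<Sum>(i, k)\<in>UNIV. x $ (i, k) *\<^sub>C vtens (A (stdb i)) (B (stdb k)))"

definition assoc_inv :: "complex ^ ('n::finite \<times> ('m::finite \<times> 'p::finite))
    \<Rightarrow> complex ^ (('n \<times> 'm) \<times> 'p)"
  where "assoc_inv x = (\<chi> p. case p of ((i, k), l) \<Rightarrow> x $ (i, (k, l)))"

definition runit_inv :: "complex ^ 'n \<Rightarrow> complex ^ ('n \<times> 1)"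
  where "runit_inv x = vtens x (stdb 1)"

definition lunit :: "complex ^ (1 \<times> 'n) \<Rightarrow> complex ^ 'n"
  where "lunit x = (\<chi> i. x $ (1, i))"

section \<open>Unital C*-algebras and minimal tensor products\<close>

class cstar_algebra = real_normed_algebra_1 + banach + complex_vector +
  fixes star :: "'a \<Rightarrow> 'a" ("_\<^sup>\<star>" [1000] 999)
  assumes scaleR_scaleC: "r *\<^sub>R x = complex_of_real r *\<^sub>C x"
    and norm_scaleC: "norm (c *\<^sub>C x) = cmod c * norm x"
    and mult_scaleC_left: "(c *\<^sub>C x) * y = c *\<^sub>C (x * y)"
    and mult_scaleC_right: "x * (c *\<^sub>C y) = c *\<^sub>C (x * y)"
    and star_star: "(x\<^sup>\<star>)\<^sup>\<star> = x"
    and star_add: "(x + y)\<^sup>\<star> = x\<^sup>\<star> + y\<^sup>\<star>"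
    and star_scaleC: "(c *\<^sub>C x)\<^sup>\<star> = cnj c *\<^sub>C x\<^sup>\<star>"
    and star_mult: "(x * y)\<^sup>\<star> = y\<^sup>\<star> * x\<^sup>\<star>"
    and cstar_identity: "norm (x\<^sup>\<star> * x) = (norm x)\<^sup>2"

definition unital_star_hom :: "('a::cstar_algebra \<Rightarrow> 'b::cstar_algebra) \<Rightarrow> bool"
  where "unital_star_hom f \<longleftrightarrow> clinear f \<and> (\<forall>x y. f (x * y) = f x * f y) \<and>
    (\<forall>x. f (x\<^sup>\<star>) = (f x)\<^sup>\<star>) \<and> f 1 = 1"

definition cstar_norm_on :: "('c::cstar_algebra) set \<Rightarrow> ('c \<Rightarrow> real) \<Rightarrow> bool"
  where "cstar_norm_on D p \<longleftrightarrow>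
    (\<forall>x\<in>D. p x \<ge> 0 \<and> (p x = 0 \<longleftrightarrow> x = 0)) \<and>
    (\<forall>x\<in>D. \<forall>y\<in>D. p (x + y) \<le> p x + p y \<and> p (x * y) \<le> p x * p y) \<and>
    (\<forall>c. \<forall>x\<in>D. p (c *\<^sub>C x) = cmod c * p x) \<and>
    (\<forall>x\<in>D. p (x\<^sup>\<star> * x) = (p x)\<^sup>2)"

text \<open>
  \<open>min_tensor t\<close>: the C*-algebra \<open>'c\<close>, with elementary tensors \<open>t a b\<close>, is the minimal tensor
  product of \<open>'a\<close> and \<open>'b\<close>. By the condition on linearly independent sets the span of the
  elementary tensors is a copy of the algebraic tensor product; it is dense, and the norm of \<open>'c\<close> restricts to the smallest
  C*-norm on it.
\<close>

definition min_tensor ::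
    "('a::cstar_algebra \<Rightarrow> 'b::cstar_algebra \<Rightarrow> 'c::cstar_algebra) \<Rightarrow> bool"
  where "min_tensor t \<longleftrightarrow>
    (\<forall>b. clinear (\<lambda>a. t a b)) \<and> (\<forall>a. clinear (t a)) \<and>
    (\<forall>a b c d. t a b * t c d = t (a * c) (b * d)) \<and>
    (\<forall>a b. (t a b)\<^sup>\<star> = t (a\<^sup>\<star>) (b\<^sup>\<star>)) \<and> t 1 1 = 1 \<and>
    (\<forall>S a. finite S \<and> \<not> cdependent S \<and> (\<Sum>b\<in>S. t (a b) b) = 0
       \<longrightarrow> (\<forall>b\<in>S. a b = 0)) \<and>
    closure (cspan {t a b | a b. True}) = UNIV \<and>
    (\<forall>p. cstar_norm_on (cspan {t a b | a b. True}) p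
       \<longrightarrow> (\<forall>x\<in>cspan {t a b | a b. True}. norm x \<le> p x))"

text \<open>The tensor product of two unital *-homomorphisms, between minimal tensor products.\<close>

definition hom_tens :: "('a::cstar_algebra \<Rightarrow> 'b::cstar_algebra \<Rightarrow> 'c::cstar_algebra)
    \<Rightarrow> ('d::cstar_algebra \<Rightarrow> 'e::cstar_algebra \<Rightarrow> 'f::cstar_algebra)
    \<Rightarrow> ('a \<Rightarrow> 'd) \<Rightarrow> ('b \<Rightarrow> 'e) \<Rightarrow> 'c \<Rightarrow> 'f"
  where "hom_tens t t' f g =
    (THE F. unital_star_hom F \<and> (\<forall>a b. F (t a b) = t' (f a) (g b)))"

section \<open>Compact quantum groups\<close>

text \<open>
  The types \<open>'a\<close>, \<open>'aa\<close>, \<open>'aaa\<close> are the C*-algebra and its second and third minimal tensor powers.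
\<close>

locale compact_quantum_group =
  fixes tA :: "'a::cstar_algebra \<Rightarrow> 'a \<Rightarrow> 'aa::cstar_algebra"
    and tA_AA :: "'a \<Rightarrow> 'aa \<Rightarrow> 'aaa::cstar_algebra"
    and tAA_A :: "'aa \<Rightarrow> 'a \<Rightarrow> 'aaa"
    and \<Delta> :: "'a \<Rightarrow> 'aa"
  assumes tA: "min_tensor tA"
    and tA_AA: "min_tensor tA_AA"
    and tAA_A: "min_tensor tAA_A"
    and tA_assoc: "tAA_A (tA a b) c = tA_AA a (tA b c)"
    and hom: "unital_star_hom \<Delta>"
    and coassoc: "hom_tens tA tAA_A \<Delta> id (\<Delta> a) = hom_tens tA tA_AA id \<Delta> (\<Delta> a)"
    and dense_left: "closure (cspan {tA b 1 * \<Delta> c | b c. True}) = UNIV"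
    and dense_right: "closure (cspan {tA 1 b * \<Delta> c | b c. True}) = UNIV"

text \<open>
  A representation on \<open>complex ^ 'n\<close> is given by its coefficient matrix \<open>u $ i $ j\<close>; the tensor
  product of \<open>complex ^ 'n\<close> with the algebra is \<open>'a ^ 'n\<close>.
\<close>

definition unitary_rep ::
    "('a::cstar_algebra \<Rightarrow> 'a \<Rightarrow> 'aa::cstar_algebra) \<Rightarrow> ('a \<Rightarrow> 'aa) \<Rightarrow> 'a ^ 'n ^ 'n \<Rightarrow> bool"
  where "unitary_rep tA \<Delta> u \<longleftrightarrow>
    (\<chi> i j. (u $ j $ i)\<^sup>\<star>) ** u = mat 1 \<and> u ** (\<chi> i j. (u $ j $ i)\<^sup>\<star>) = mat 1 \<and>
    (\<forall>i j. \<Delta> (u $ i $ j) = (\<Sum>k\<in>UNIV. tA (u $ i $ k) (u $ k $ j)))"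

definition rep_map :: "('a::cstar_algebra) ^ 'n ^ 'n \<Rightarrow> complex ^ 'n \<Rightarrow> 'a ^ 'n"
  where "rep_map u \<psi> = (\<chi> i. \<Sum>j\<in>UNIV. \<psi> $ j *\<^sub>C u $ i $ j)"

definition amplify :: "(complex ^ 'n \<Rightarrow> complex ^ 'm) \<Rightarrow> ('a::cstar_algebra) ^ 'n \<Rightarrow> 'a ^ 'm"
  where "amplify A x = (\<chi> k. \<Sum>i\<in>UNIV. (A (stdb i) $ k) *\<^sub>C x $ i)"

definition arrows :: "('a::cstar_algebra) ^ 'n ^ 'n \<Rightarrow> 'a ^ 'm ^ 'm
    \<Rightarrow> (complex ^ 'n \<Rightarrow> complex ^ 'm) set"
  where "arrows u v = {A. clinear A \<and> (\<forall>\<psi>. amplify A (rep_map u \<psi>) = rep_map v (A \<psi>))}"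

definition irreducible_rep :: "('a::cstar_algebra) ^ 'n ^ 'n \<Rightarrow> bool"
  where "irreducible_rep u \<longleftrightarrow> arrows u u = {\<lambda>\<psi>. c *\<^sub>C \<psi> | c. True}"

definition rep_tens :: "('a::cstar_algebra) ^ 'n ^ 'n \<Rightarrow> 'a ^ 'm ^ 'm
    \<Rightarrow> 'a ^ ('n \<times> 'm) ^ ('n \<times> 'm)"
  where "rep_tens u v = (\<chi> ip jq. case (ip, jq) of ((i, p), (j, q)) \<Rightarrow> u $ i $ j * v $ p $ q)"

abbreviation trivial_rep :: "('a::cstar_algebra) ^ 1 ^ 1"
  where "trivial_rep \<equiv> mat 1"

text \<open>
  \<open>zigzag R R'\<close> is the equation \<open>(R'* \<otimes> 1) (1 \<otimes> R) = 1\<close>, with the identifications of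
  \<open>H \<otimes> \<complex>\<close> and \<open>\<complex> \<otimes> H\<close> with \<open>H\<close> and the associativity of tensor products made explicit.
\<close>

definition zigzag :: "(complex ^ 1 \<Rightarrow> complex ^ ('m::finite \<times> 'n::finite)) \<Rightarrow>
    (complex ^ 1 \<Rightarrow> complex ^ ('n \<times> 'm)) \<Rightarrow> bool"
  where "zigzag R R' \<longleftrightarrow>
    (\<forall>\<psi>. lunit (map_tens (hadjoint Cn Cn R') id
            (assoc_inv (map_tens id R (runit_inv \<psi>)))) = \<psi>)"

definition conjugate_equations :: "(complex ^ 1 \<Rightarrow> complex ^ ('m::finite \<times> 'n::finite)) \<Rightarrow>
    (complex ^ 1 \<Rightarrow> complex ^ ('n \<times> 'm)) \<Rightarrow> bool"
  where "conjugate_equations R R' \<longleftrightarrow> zigzag R R' \<and> zigzag R' R"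

section \<open>Ergodic actions and their spectral functor\<close>

locale nondegenerate_ergodic_action =
  compact_quantum_group tA tA_AA tAA_A \<Delta>
  for tA :: "'a::cstar_algebra \<Rightarrow> 'a \<Rightarrow> 'aa::cstar_algebra"
    and tA_AA :: "'a \<Rightarrow> 'aa \<Rightarrow> 'aaa::cstar_algebra"
    and tAA_A :: "'aa \<Rightarrow> 'a \<Rightarrow> 'aaa"
    and \<Delta> :: "'a \<Rightarrow> 'aa" +
  fixes tB :: "'b::cstar_algebra \<Rightarrow> 'a \<Rightarrow> 'ba::cstar_algebra"
    and tB_AA :: "'b \<Rightarrow> 'aa \<Rightarrow> 'baa::cstar_algebra"
    and tBA_A :: "'ba \<Rightarrow> 'a \<Rightarrow> 'baa"
    and \<eta> :: "'b \<Rightarrow> 'ba"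
  assumes tB: "min_tensor tB"
    and tB_AA: "min_tensor tB_AA"
    and tBA_A: "min_tensor tBA_A"
    and tB_assoc: "tBA_A (tB b x) y = tB_AA b (tA x y)"
    and action_hom: "unital_star_hom \<eta>"
    and action: "hom_tens tB tBA_A \<eta> id (\<eta> b) = hom_tens tB tB_AA id \<Delta> (\<eta> b)"
    and nondegenerate: "closure (cspan {\<eta> b * tB 1 x | b x. True}) = UNIV"
    and ergodic: "{b. \<eta> b = tB b 1} = {c *\<^sub>C 1 | c. True}"

text \<open>
  The conjugated spectral space of \<open>u\<close>. By ergodicity the sum in the inner product is a scalar
  multiple of \<open>1\<close>.
\<close>

definition Lbar :: "('b::cstar_algebra \<Rightarrow> 'a::cstar_algebra \<Rightarrow> 'ba::cstar_algebra) \<Rightarrow> ('b \<Rightarrow> 'ba)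
    \<Rightarrow> 'a ^ 'n ^ 'n \<Rightarrow> (complex ^ 'n \<Rightarrow> 'b) cconj hspace"
  where "Lbar tB \<eta> u = \<lparr>
    hcarrier = {bar T | T. clinear T \<and>
      (\<forall>\<psi>. \<eta> (T \<psi>) = (\<Sum>i\<in>UNIV. tB (T (stdb i)) (rep_map u \<psi> $ i)))},
    hinner = (\<lambda>S T. THE c. c *\<^sub>C 1 = (\<Sum>i\<in>UNIV. unbar S (stdb i) * (unbar T (stdb i))\<^sup>\<star>))\<rparr>"

definition Lbar_arrow :: "(complex ^ 'n \<Rightarrow> complex ^ 'm)
    \<Rightarrow> (complex ^ 'n \<Rightarrow> 'b) cconj \<Rightarrow> (complex ^ 'm \<Rightarrow> 'b) cconj"
  where "Lbar_arrow A T = bar (unbar T \<circ> hadjoint Cn Cn A)"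

text \<open>The unit of the spectral space of the trivial representation, which is identified with \<open>\<complex>\<close>.\<close>

definition Lbar_unit :: "(complex ^ 1 \<Rightarrow> 'b::cstar_algebra) cconj"
  where "Lbar_unit = bar (\<lambda>z. (z $ 1) *\<^sub>C 1)"

definition spec_mult :: "(complex ^ 'n \<Rightarrow> 'b::cstar_algebra) \<Rightarrow> (complex ^ 'm \<Rightarrow> 'b)
    \<Rightarrow> complex ^ ('n \<times> 'm) \<Rightarrow> 'b"
  where "spec_mult S T x = (\<Sum>(i, k)\<in>UNIV. x $ (i, k) *\<^sub>C (S (stdb i) * T (stdb k)))"

definition S_map :: "('b::cstar_algebra \<Rightarrow> 'a::cstar_algebra \<Rightarrow> 'ba::cstar_algebra) \<Rightarrow> ('b \<Rightarrow> 'ba)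
    \<Rightarrow> 'a ^ 'n ^ 'n \<Rightarrow> 'a ^ 'm ^ 'm
    \<Rightarrow> ((complex ^ 'n \<Rightarrow> 'b) cconj \<times> (complex ^ 'm \<Rightarrow> 'b) cconj \<Rightarrow> complex)
    \<Rightarrow> (complex ^ ('n \<times> 'm) \<Rightarrow> 'b) cconj"
  where "S_map tB \<eta> u v =
    tens_lift (Lbar tB \<eta> u) (Lbar tB \<eta> v) (\<lambda>S T. bar (spec_mult (unbar S) (unbar T)))"

text \<open>
  For \<open>R\<close> an arrow from the trivial representation to the tensor product of \<open>u\<close> and \<open>v\<close>,
  \<open>R_hat tB \<eta> u v R\<close> is the image of \<open>1\<close> under the adjoint of \<open>S_map\<close> composed with
  \<open>Lbar_arrow R\<close>. Linear maps defined on \<open>\<complex>\<close> are identified with the image of \<open>1\<close>, so that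
  the operator norm is the norm of the vector.
\<close>

definition R_hat :: "('b::cstar_algebra \<Rightarrow> 'a::cstar_algebra \<Rightarrow> 'ba::cstar_algebra) \<Rightarrow> ('b \<Rightarrow> 'ba)
    \<Rightarrow> 'a ^ 'n ^ 'n \<Rightarrow> 'a ^ 'm ^ 'm \<Rightarrow> (complex ^ 1 \<Rightarrow> complex ^ ('n \<times> 'm))
    \<Rightarrow> ((complex ^ 'n \<Rightarrow> 'b) cconj \<times> (complex ^ 'm \<Rightarrow> 'b) cconj \<Rightarrow> complex)"
  where "R_hat tB \<eta> u v R =
    hadjoint (tens_space (Lbar tB \<eta> u) (Lbar tB \<eta> v)) (Lbar tB \<eta> (rep_tens u v))
      (S_map tB \<eta> u v) (Lbar_arrow R Lbar_unit)"

definition J_bar :: "(complex ^ 'n \<Rightarrow> complex ^ 'm) \<Rightarrow> (complex ^ 'n \<Rightarrow> 'b::cstar_algebra) cconj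
    \<Rightarrow> (complex ^ 'm \<Rightarrow> 'b) cconj"
  where "J_bar j T = bar (\<lambda>\<psi>. (unbar T (antilinear_adjoint Cn Cn j \<psi>))\<^sup>\<star>)"

definition d_hat :: "'v hspace \<Rightarrow> 'v \<Rightarrow> 'w hspace \<Rightarrow> 'w \<Rightarrow> real"
  where "d_hat H x K y = hnorm H x * hnorm K y"

text \<open>
  Quantum multiplicity, for an antilinear invertible map \<open>J\<close> from \<open>H\<close> to \<open>K\<close>; both traces are
  nonnegative reals.
\<close>

definition q_mult :: "('v::complex_vector) hspace \<Rightarrow> ('w::complex_vector) hspace \<Rightarrow> ('v \<Rightarrow> 'w)
    \<Rightarrow> real"
  where "q_mult H K J = (let Q = J \<circ> antilinear_adjoint H K J in
    sqrt (Re (htrace K Q * htrace K (inv_into (hcarrier K) Q))))"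

end

(*
  Coefficients of u and of its conjugate are related by R, which makes J map L_u onto L_ubar and
  gives (L_R 1, S T) = (J T, S) for S in L_ubar and T in L_u; expanding in orthonormal bases
  yields the formulas for the adjoints of S_{ubar,u} and S_{u,ubar}. Their norms are the
  Hilbert-Schmidt norms of J and of its inverse, hence the traces in q-mult(u). That L_u is
  finite dimensional, without which the traces would be meaningless, is Bessel's inequality:
  the sum of |J T|^2 over an orthonormal set of T is at most |L_R 1|^2, while |J T| is bounded
  below because the inverse of J satisfies the same inequality. Definiteness of the inner
  product on L_u amounts to the positivity of a a^* in a C*-algebra.
*)

theory Submission
  imports Defs
begin

text \<open>The hypotheses are symmetric under exchanging \<open>u\<close>, \<open>R\<close>,
  \<open>j\<close> with \<open>ubar\<close>, \<open>Rbar\<close>, \<open>inv j\<close>, once a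
  conjugate equation has shown that \<open>Rbar\<close> arises from \<open>inv j\<close> as
  \<open>R\<close> does from \<open>j\<close>. The predicate \<open>conjugation\<close> records one
  such triple, so each fact about spectral spaces is proved once and used in both directions. Finite
  dimension has to precede any adjoint between spectral spaces: \<open>tens_lift\<close>, the
  adjoint of \<open>S_map\<close> and the traces are all evaluated through orthonormal bases.
  Bessel's inequality is therefore applied directly in the spectral space of the tensor product, to
  the products of J T with T. These are orthogonal because multiplication is isometric, an inner sum
  over T being a scalar by ergodicity. Positivity is developed without spectra. The norm condition
  \<open>norm (t *\<^sub>R 1 - h) \<le> t\<close>, which is stable under addition and guarantees a
  square root, stands for the spectrum of \<open>h\<close> being nonnegative; roots that commute
  with everything commuting with \<open>h\<close> replace the functional calculus.\<close>

section \<open>Positive elements of C*-algebras\<close>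

lemma scaleC_left_commute: "a *\<^sub>C b *\<^sub>C x = b *\<^sub>C a *\<^sub>C (x::'a::complex_vector)"
  by (simp add: scaleC_scaleC mult.commute)

lemma star_zero [simp]: "(0::'a::cstar_algebra)\<^sup>\<star> = 0"
  using star_add[of 0 "0::'a"] by simp

lemma star_minus: "(- x)\<^sup>\<star> = - (x\<^sup>\<star> :: 'a::cstar_algebra)"
  using star_add[of x "-x"] by (simp add: minus_unique)

lemma star_diff: "(x - y)\<^sup>\<star> = x\<^sup>\<star> - (y\<^sup>\<star> :: 'a::cstar_algebra)"
  using star_add[of x "-y"] by (simp add: star_minus)

lemma star_one [simp]: "(1::'a::cstar_algebra)\<^sup>\<star> = 1"
  by (metis mult.right_neutral mult.left_neutral star_mult star_star)

lemma star_scaleR: "(r *\<^sub>R x)\<^sup>\<star> = r *\<^sub>R (x\<^sup>\<star> :: 'a::cstar_algebra)"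
  by (simp add: scaleR_scaleC star_scaleC)

lemma star_sum: "(\<Sum>i\<in>I. f i)\<^sup>\<star> = (\<Sum>i\<in>I. (f i)\<^sup>\<star> :: 'a::cstar_algebra)"
  by (induction I rule: infinite_finite_induct) (simp_all add: star_add)

lemma norm_star [simp]: "norm (x\<^sup>\<star>) = norm (x::'a::cstar_algebra)"
proof -
  have le: "norm y \<le> norm (y\<^sup>\<star>)" for y :: 'a
  proof (cases "y = 0")
    case False
    have "norm y * norm y \<le> norm (y\<^sup>\<star>) * norm y"
      using cstar_identity[of y] norm_mult_ineq[of "y\<^sup>\<star>" y] by (simp add: power2_eq_square)
    then show ?thesis using False by simp
  qed simp
  show ?thesis using le[of x] le[of "x\<^sup>\<star>"] by (simp add: star_star)
qed

lemma star_mult_eq_0_iff: "x\<^sup>\<star> * x = 0 \<longleftrightarrow> (x::'a::cstar_algebra) = 0"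
  using cstar_identity[of x] by auto

lemma tendsto_star:
  assumes "(f \<longlongrightarrow> (l::'a::cstar_algebra)) F"
  shows "((\<lambda>n. (f n)\<^sup>\<star>) \<longlongrightarrow> l\<^sup>\<star>) F"
proof -
  have "((\<lambda>n. f n - l) \<longlongrightarrow> 0) F" using assms by (simp add: LIM_zero)
  then have "((\<lambda>n. norm ((f n)\<^sup>\<star> - l\<^sup>\<star>)) \<longlongrightarrow> 0) F"
    by (simp flip: star_diff add: tendsto_norm_zero_iff)
  then show ?thesis by (simp add: tendsto_norm_zero_iff LIM_zero_iff)
qed

text \<open>
  Writing \<open>h = 1 - y\<close>, the square root is \<open>1 - w\<close> with \<open>w = (y + w\<^sup>2) / 2\<close>; the iteration for
  \<open>w\<close> is dominated by the same iteration for the real number \<open>1\<close>.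
\<close>

lemma square_root_near_1:
  fixes h :: "'a::cstar_algebra"
  assumes sa: "h\<^sup>\<star> = h" and h: "norm (1 - h) \<le> 1"
  shows "\<exists>s. s\<^sup>\<star> = s \<and> s * s = h \<and> norm (1 - s) \<le> 1 \<and>
    (\<forall>z. z * h = h * z \<longrightarrow> z * s = s * z)"
proof -
  define w where "w = rec_nat (0::'a) (\<lambda>_ x. (1/2) *\<^sub>R ((1 - h) + x * x))"
  define v where "v = rec_nat (0::real) (\<lambda>_ x. (1 + x * x) / 2)"
  have w0: "w 0 = 0" and wS: "w (Suc n) = (1/2) *\<^sub>R ((1 - h) + w n * w n)" for n
    by (simp_all add: w_def)
  have v0: "v 0 = 0" and vS: "v (Suc n) = (1 + v n * v n) / 2" for n
    by (simp_all add: v_def)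
  have v: "0 \<le> v n \<and> v n \<le> 1" for n
    by (induction n) (simp_all add: v0 vS mult_le_one)
  have wv: "norm (w n) \<le> v n" for n
  proof (induction n)
    case (Suc n)
    have "norm (w n * w n) \<le> v n * v n"
      using norm_mult_ineq[of "w n" "w n"] mult_mono'[OF Suc Suc] by simp
    then have "norm ((1 - h) + w n * w n) \<le> 1 + v n * v n"
      using norm_triangle_ineq[of "1 - h" "w n * w n"] h by linarith
    then show ?case by (simp add: wS vS)
  qed (simp add: w0 v0)
  \<comment> \<open>The increments of \<open>w\<close> are dominated by those of \<open>v\<close>: a
    difference of squares is split as \<open>(y - x) * y + x * (y - x)\<close>, which is valid
    without commutativity.\<close>
  have dwv: "norm (w (Suc n) - w n) \<le> v (Suc n) - v n" for n
  proof (induction n)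
    case 0
    show ?case using h by (simp add: w0 v0 wS vS)
  next
    case (Suc n)
    have "(1/2) *\<^sub>R ((1 - h) + y * y) - (1/2) *\<^sub>R ((1 - h) + x * x)
      = (1/2) *\<^sub>R ((y - x) * y + x * (y - x))" for x y :: 'a
      by (simp add: algebra_simps)
    from this[of "w (Suc n)" "w n"]
    have eq: "w (Suc (Suc n)) - w (Suc n)
      = (1/2) *\<^sub>R ((w (Suc n) - w n) * w (Suc n) + w n * (w (Suc n) - w n))"
      by (simp only: wS)
    have "norm ((w (Suc n) - w n) * w (Suc n)) \<le> (v (Suc n) - v n) * v (Suc n)"
      by (rule order_trans[OF norm_mult_ineq mult_mono'[OF Suc wv]]) simp_all
    moreover have "norm (w n * (w (Suc n) - w n)) \<le> v n * (v (Suc n) - v n)"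
      by (rule order_trans[OF norm_mult_ineq mult_mono'[OF wv Suc]]) simp_all
    ultimately have "norm ((w (Suc n) - w n) * w (Suc n) + w n * (w (Suc n) - w n))
      \<le> (v (Suc n) - v n) * v (Suc n) + v n * (v (Suc n) - v n)"
      using norm_triangle_ineq[of "(w (Suc n) - w n) * w (Suc n)" "w n * (w (Suc n) - w n)"]
      by linarith
    also have "\<dots> = v (Suc n) * v (Suc n) - v n * v n" by (simp add: algebra_simps)
    also have "\<dots> = 2 * (v (Suc (Suc n)) - v (Suc n))"
      using vS[of n] vS[of "Suc n"] by (simp add: field_simps)
    finally show ?case by (simp add: eq)
  qed
  \<comment> \<open>\<open>v\<close> increases and is bounded by 1, so its increments are summable.
    They dominate those of \<open>w\<close>, which therefore converges although the recursion need
    not be a strict contraction.\<close>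
  have "incseq v" by (rule incseq_SucI) (use order_trans[OF norm_ge_zero dwv] in simp)
  then have "convergent v"
    using v by (intro Bseq_monoseq_convergent) (auto simp: Bseq_def monoseq_def incseq_def intro!: exI[of _ 1])
  then have "summable (\<lambda>n. v (Suc n) - v n)"
    using telescope_summable by (auto simp: convergent_def)
  then have "summable (\<lambda>n. w (Suc n) - w n)"
    by (rule summable_comparison_test') (use dwv in blast)
  then have "convergent (\<lambda>n. \<Sum>k<n. w (Suc k) - w k)" by (simp add: summable_iff_convergent)
  then have "convergent w" by (simp add: sum_lessThan_telescope w0)
  then obtain x where x: "w \<longlonglongrightarrow> x" by (auto simp: convergent_def)
  have w_lim: "(\<lambda>n. w (Suc n)) \<longlonglongrightarrow> (1/2) *\<^sub>R ((1 - h) + x * x)"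
    unfolding wS by (intro tendsto_intros x)
  have xx: "x = (1/2) *\<^sub>R ((1 - h) + x * x)"
    using LIMSEQ_unique[OF LIMSEQ_Suc[OF x] w_lim] .
  have wsa: "(w n)\<^sup>\<star> = w n" for n
    by (induction n) (simp_all add: w0 wS star_scaleR star_add star_diff star_mult sa)
  have xsa: "x\<^sup>\<star> = x"
    using LIMSEQ_unique[OF tendsto_star[OF x]] x by (simp add: wsa)
  have comm: "z * x = x * z" if z: "z * h = h * z" for z
  proof -
    have zw: "z * w n = w n * z" for n
    proof (induction n)
      case (Suc n)
      have "z * (w n * w n) = w n * w n * z"
        using Suc by (metis mult.assoc)
      then show ?case using z by (simp add: wS algebra_simps)
    qed (simp add: w0)
    have "(\<lambda>n. z * w n) \<longlonglongrightarrow> z * x" "(\<lambda>n. w n * z) \<longlonglongrightarrow> x * z"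
      by (intro tendsto_intros x)+
    then show ?thesis using LIMSEQ_unique by (simp add: zw)
  qed
  \<comment> \<open>This becomes \<open>norm (1 - s) \<le> 1\<close>, the very hypothesis under
    which a root of \<open>s\<close> can be taken in turn.\<close>
  have nx: "norm x \<le> 1"
    by (rule LIMSEQ_le_const2[OF tendsto_norm[OF x]]) (use wv v order_trans in blast)
  have "2 *\<^sub>R x = (1 - h) + x * x" by (subst xx) simp
  then have "x * x = h - 1 + (x + x)" by (simp add: scaleR_2 algebra_simps)
  then have "(1 - x) * (1 - x) = h" by (simp add: algebra_simps)
  moreover have "(1 - x)\<^sup>\<star> = 1 - x" by (simp add: star_diff xsa)
  moreover have "norm (1 - (1 - x)) \<le> 1" using nx by simp
  moreover have "\<forall>z. z * h = h * z \<longrightarrow> z * (1 - x) = (1 - x) * z"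
    using comm by (simp add: right_diff_distrib left_diff_distrib)
  ultimately show ?thesis by blast
qed

text \<open>Since \<open>q\<close> and \<open>s\<close> commute, the mixed terms of
  \<open>w\<^sup>\<star> * w\<close> for \<open>w = q + \<i> *\<^sub>C s\<close> cancel. So
  \<open>w\<close> has squared norm \<open>cmod c\<close>, and \<open>q\<close> is its real
  part.\<close>

lemma norm_le_commuting_squares:
  fixes q :: "'a::cstar_algebra"
  assumes q: "q\<^sup>\<star> = q" and s: "s\<^sup>\<star> = s" and comm: "q * s = s * q"
    and eq: "q * q + s * s = c *\<^sub>C 1"
  shows "(norm q)\<^sup>2 \<le> cmod c"
proof -
  define w where "w = q + \<i> *\<^sub>C s"
  have ws: "w\<^sup>\<star> = q - \<i> *\<^sub>C s"
    by (simp add: w_def star_add star_scaleC q s)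
  have "w\<^sup>\<star> * w = q * q + s * s + (\<i> *\<^sub>C (q * s) - \<i> *\<^sub>C (s * q))"
    unfolding ws by (simp add: w_def algebra_simps mult_scaleC_left mult_scaleC_right scaleC_scaleC scaleC_one)
  then have "w\<^sup>\<star> * w = c *\<^sub>C 1" using eq comm by simp
  then have nw: "(norm w)\<^sup>2 = cmod c" by (metis cstar_identity norm_scaleC norm_one mult.right_neutral)
  have "2 *\<^sub>R q = w + w\<^sup>\<star>" unfolding ws unfolding w_def by (simp add: scaleR_2)
  then have "2 * norm q \<le> norm w + norm w"
    by (metis norm_star norm_triangle_ineq norm_scaleR abs_numeral)
  then show ?thesis using nw by (simp flip: nw)
qed

text \<open>Chosen to avoid spectra. The price is that closure under sums
  (\<open>positive_add\<close>) and the positivity of \<open>a\<^sup>\<star> * a\<close>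
  (\<open>positive_star_mult\<close>) become theorems.\<close>

definition positive :: "'a::cstar_algebra \<Rightarrow> bool"
  where "positive h \<longleftrightarrow> (\<exists>q. q\<^sup>\<star> = q \<and> h = q * q)"

lemma positive_star: "positive h \<Longrightarrow> h\<^sup>\<star> = h"
  by (auto simp: positive_def star_mult)

lemma positive_scaleR:
  assumes "positive h" "0 \<le> r"
  shows "positive (r *\<^sub>R h)"
proof -
  obtain q where q: "q\<^sup>\<star> = q" "h = q * q" using assms(1) by (auto simp: positive_def)
  then have "(sqrt r *\<^sub>R q)\<^sup>\<star> = sqrt r *\<^sub>R q \<and> r *\<^sub>R h = (sqrt r *\<^sub>R q) * (sqrt r *\<^sub>R q)"
    using assms(2) by (simp add: star_scaleR)
  then show ?thesis unfolding positive_def by blast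
qed

text \<open>\<open>square_root_near_1\<close> for \<open>h\<close> divided by \<open>t\<close>, with
  the root multiplied by \<open>sqrt t\<close>. The root satisfies the same condition with
  \<open>sqrt t\<close> for \<open>t\<close>, so the lemma can be iterated.\<close>

lemma positive_square_root_of_norm:
  fixes h :: "'a::cstar_algebra"
  assumes sa: "h\<^sup>\<star> = h" and t: "0 < t" and h: "norm (t *\<^sub>R 1 - h) \<le> t"
  shows "\<exists>s. s\<^sup>\<star> = s \<and> s * s = h \<and> norm (sqrt t *\<^sub>R 1 - s) \<le> sqrt t \<and>
    (\<forall>z. z * h = h * z \<longrightarrow> z * s = s * z)"
proof -
  let ?h = "inverse t *\<^sub>R h"
  have "1 - ?h = inverse t *\<^sub>R (t *\<^sub>R 1 - h)" using t by (simp add: algebra_simps)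
  then have "norm (1 - ?h) = inverse t * norm (t *\<^sub>R 1 - h)" using t by simp
  also have "\<dots> \<le> inverse t * t" using t h by (intro mult_left_mono) auto
  finally have n1: "norm (1 - ?h) \<le> 1" using t by simp
  have hsa: "?h\<^sup>\<star> = ?h" by (simp add: star_scaleR sa)
  obtain s where s: "s\<^sup>\<star> = s" "s * s = ?h" "norm (1 - s) \<le> 1"
    and comm: "\<forall>z. z * ?h = ?h * z \<longrightarrow> z * s = s * z"
    using square_root_near_1[OF hsa n1] by blast
  let ?s = "sqrt t *\<^sub>R s"
  have "sqrt t *\<^sub>R 1 - ?s = sqrt t *\<^sub>R (1 - s)" by (simp add: algebra_simps)
  then have "norm (sqrt t *\<^sub>R 1 - ?s) \<le> sqrt t"
    using s(3) t by (simp add: mult_left_le)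
  moreover have "?s\<^sup>\<star> = ?s" using s(1) by (simp add: star_scaleR)
  moreover have "?s * ?s = (sqrt t * sqrt t) *\<^sub>R (s * s)"
    by (simp only: mult_scaleR_left mult_scaleR_right scaleR_scaleR)
  then have "?s * ?s = h" using s(2) t by simp
  moreover have "\<forall>z. z * h = h * z \<longrightarrow> z * ?s = ?s * z" using comm by simp
  ultimately show ?thesis by blast
qed

text \<open>Squares satisfy the norm condition. As \<open>q * q\<close> has norm at most
  \<open>t\<close>, the difference has a root \<open>s\<close>, which commutes with
  \<open>q\<close>; then \<open>s * s + q * q\<close> is the scalar \<open>t\<close>, and this
  bounds the norm of \<open>s\<close>.\<close>

lemma norm_diff_square_le:
  fixes q :: "'a::cstar_algebra"
  assumes q: "q\<^sup>\<star> = q" and t: "0 < t" "(norm q)\<^sup>2 \<le> t"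
  shows "norm (t *\<^sub>R 1 - q * q) \<le> t"
proof -
  have nq: "norm (q * q) \<le> t" using cstar_identity[of q] q t by simp
  then have "norm (t *\<^sub>R 1 - (t *\<^sub>R 1 - q * q)) \<le> t" by simp
  moreover have "(t *\<^sub>R 1 - q * q)\<^sup>\<star> = t *\<^sub>R 1 - q * q"
    by (simp add: star_diff star_scaleR star_mult q)
  ultimately obtain s where s: "s\<^sup>\<star> = s" "s * s = t *\<^sub>R 1 - q * q"
    and comm: "\<forall>z. z * (t *\<^sub>R 1 - q * q) = (t *\<^sub>R 1 - q * q) * z \<longrightarrow> z * s = s * z"
    using positive_square_root_of_norm[OF _ t(1)] by blast
  have "s * q = q * s" using comm[rule_format, of q] by (simp add: algebra_simps)
  moreover have "s * s + q * q = complex_of_real t *\<^sub>C 1" by (simp add: s scaleR_scaleC)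
  ultimately have "(norm s)\<^sup>2 \<le> t" using norm_le_commuting_squares[OF s(1) q] t by simp
  then show ?thesis using cstar_identity[of s] s by simp
qed

text \<open>Squares satisfy the norm condition, the triangle inequality adds two such conditions,
  and the sum of the conditions yields a root of \<open>g + h\<close>.\<close>

lemma positive_add:
  assumes "positive g" "positive (h::'a::cstar_algebra)"
  shows "positive (g + h)"
proof -
  obtain p q where pq: "p\<^sup>\<star> = p" "g = p * p" "q\<^sup>\<star> = q" "h = q * q"
    using assms by (auto simp: positive_def)
  \<comment> \<open>The summand 1 keeps both constants strictly positive even if \<open>p\<close> or
    \<open>q\<close> vanishes.\<close>
  define a b where "a = (norm p)\<^sup>2 + 1" and "b = (norm q)\<^sup>2 + 1"
  have ab: "a > 0" "b > 0" by (simp_all add: a_def b_def add_nonneg_pos)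
  have "norm (a *\<^sub>R 1 - g) \<le> a" "norm (b *\<^sub>R 1 - h) \<le> b"
    using norm_diff_square_le[of p a] norm_diff_square_le[of q b] pq ab by (simp_all add: a_def b_def)
  then have "norm ((a *\<^sub>R 1 - g) + (b *\<^sub>R 1 - h)) \<le> a + b" by (rule norm_triangle_mono)
  then have "norm ((a + b) *\<^sub>R 1 - (g + h)) \<le> a + b" by (simp add: algebra_simps)
  then show ?thesis
    using positive_square_root_of_norm[of "g + h" "a + b"] ab assms
    unfolding positive_def by (metis add_pos_pos star_add star_mult)
qed

lemma positive_0: "positive 0"
  by (auto simp: positive_def intro!: exI[of _ 0])

lemma positive_sum: "(\<And>i. i \<in> I \<Longrightarrow> positive (f i)) \<Longrightarrow> positive (\<Sum>i\<in>I. f i)"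
  by (induction I rule: infinite_finite_induct) (simp_all add: positive_add positive_0)

text \<open>The definition of \<open>positive\<close> only promises some self-adjoint root. The root
  built by iteration again meets the norm condition, so it has a root of its own and is
  positive.\<close>

lemma positive_square_root:
  fixes h :: "'a::cstar_algebra"
  assumes "positive h"
  shows "\<exists>s. positive s \<and> s * s = h \<and> (\<forall>z. z * h = h * z \<longrightarrow> z * s = s * z)"
proof -
  obtain q where q: "q\<^sup>\<star> = q" "h = q * q" using assms by (auto simp: positive_def)
  define t where "t = (norm q)\<^sup>2 + 1"
  have t: "t > 0" by (simp add: t_def add_nonneg_pos)
  have n: "norm (t *\<^sub>R 1 - h) \<le> t"
    using norm_diff_square_le[of q t] q t by (simp add: t_def)
  obtain s where s: "s\<^sup>\<star> = s" "s * s = h" "norm (sqrt t *\<^sub>R 1 - s) \<le> sqrt t"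
    and comm: "\<forall>z. z * h = h * z \<longrightarrow> z * s = s * z"
    using positive_square_root_of_norm[OF positive_star[OF assms] t n] by blast
  have "0 < sqrt t" using t by simp
  then obtain r where "r\<^sup>\<star> = r" "r * r = s"
    using positive_square_root_of_norm[OF s(1)] s(3) by blast
  then have "positive s" unfolding positive_def by metis
  then show ?thesis using s(2) comm by blast
qed

text \<open>Here \<open>h\<close> is \<open>- (q * q)\<close>, which commutes with \<open>q\<close>;
  hence so does its root \<open>s\<close>. Then \<open>q * q + s * s\<close> is the scalar 0, and
  \<open>norm_le_commuting_squares\<close> gives \<open>q = 0\<close>.\<close>

lemma positive_add_eq_0:
  assumes g: "positive g" and h: "positive (h::'a::cstar_algebra)" and "g + h = 0"
  shows "g = 0"
proof -
  obtain q where q: "q\<^sup>\<star> = q" "g = q * q" using g by (auto simp: positive_def)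
  have hg: "h = - g" using assms(3) by (simp add: eq_neg_iff_add_eq_0 add.commute)
  obtain s where s: "positive s" "s * s = h" and comm: "\<forall>z. z * h = h * z \<longrightarrow> z * s = s * z"
    using positive_square_root[OF h] by blast
  have "q * s = s * q" by (rule comm[rule_format]) (simp add: hg q mult.assoc)
  moreover have "q * q + s * s = 0 *\<^sub>C 1"
    using s hg q by (simp add: scaleC_complex_def)
  ultimately have "(norm q)\<^sup>2 \<le> 0"
    using norm_le_commuting_squares[of q s 0] q positive_star[OF s(1)] by simp
  then show ?thesis by (simp add: q)
qed

text \<open>Twice this element is the sum of the squares of the self-adjoint
  \<open>b + b\<^sup>\<star>\<close> and \<open>\<i> *\<^sub>C (b - b\<^sup>\<star>)\<close>: the
  squares of \<open>b\<close> and of its star cancel.\<close>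

lemma positive_commutator_sum: "positive (b\<^sup>\<star> * b + b * (b\<^sup>\<star> :: 'a::cstar_algebra))"
proof -
  let ?h = "b + b\<^sup>\<star>" and ?k = "\<i> *\<^sub>C (b - b\<^sup>\<star>)"
  have "?k\<^sup>\<star> = ?k"
    by (simp add: star_scaleC star_diff star_star complex_vector.scale_right_diff_distrib)
  moreover have "?h\<^sup>\<star> = ?h" by (simp add: star_add star_star add.commute)
  ultimately have "positive (?h * ?h)" "positive (?k * ?k)"
    unfolding positive_def by blast+
  then have "positive ((1/2) *\<^sub>R (?h * ?h + ?k * ?k))"
    by (intro positive_scaleR positive_add) simp_all
  moreover have "?h * ?h + ?k * ?k = 2 *\<^sub>R (b\<^sup>\<star> * b + b * b\<^sup>\<star>)"
    by (simp add: mult_scaleC_left mult_scaleC_right scaleC_scaleC scaleC_one algebra_simps scaleR_2)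
  ultimately show ?thesis by simp
qed

text \<open>
  If \<open>b\<^sup>\<star> b = - q\<^sup>2\<close> and hence \<open>b b\<^sup>\<star> = p\<^sup>2\<close>, then \<open>c = b q\<close> satisfies \<open>c\<^sup>\<star> c = - q\<^sup>4\<close> and
  \<open>c c\<^sup>\<star> = - p\<^sup>4\<close>, so that \<open>c\<^sup>\<star> c + c c\<^sup>\<star>\<close> is both positive and negative.
\<close>

lemma negative_star_mult_eq_0:
  fixes b :: "'a::cstar_algebra"
  assumes q: "q\<^sup>\<star> = q" and b: "b\<^sup>\<star> * b = - (q * q)"
  shows "q = 0"
proof -
  have pq: "positive (q * q)" using q by (auto simp: positive_def)
  have "positive (b * b\<^sup>\<star>)"
    using positive_add[OF positive_commutator_sum[of b] pq] b by simp
  then obtain p where p: "p\<^sup>\<star> = p" "b * b\<^sup>\<star> = p * p" by (auto simp: positive_def)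
  let ?c = "b * q"
  have "?c\<^sup>\<star> * ?c = q * (b\<^sup>\<star> * b) * q" by (simp add: star_mult q mult.assoc)
  then have c1: "?c\<^sup>\<star> * ?c = - ((q * q) * (q * q))" by (simp add: b mult.assoc)
  have "?c * ?c\<^sup>\<star> = b * (q * q) * b\<^sup>\<star>" by (simp add: star_mult q mult.assoc)
  also have "\<dots> = - (b * (b\<^sup>\<star> * b) * b\<^sup>\<star>)" by (simp add: b)
  also have "\<dots> = - ((b * b\<^sup>\<star>) * (b * b\<^sup>\<star>))" by (simp add: mult.assoc)
  finally have c2: "?c * ?c\<^sup>\<star> = - ((p * p) * (p * p))" by (simp add: p)
  have sq: "positive ((q * q) * (q * q))" "positive ((p * p) * (p * p))"
    unfolding positive_def by (metis p(1) q star_mult)+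
  \<comment> \<open>The argument equals \<open>- ((q * q) * (q * q))\<close>, so two positive
    elements have sum 0.\<close>
  have "positive ((?c\<^sup>\<star> * ?c + ?c * ?c\<^sup>\<star>) + (p * p) * (p * p))"
    by (intro positive_add positive_commutator_sum sq)
  then have "(q * q) * (q * q) = 0"
    using positive_add_eq_0[OF sq(1)] unfolding c1 c2 by fastforce
  then show ?thesis using q by (metis star_mult star_mult_eq_0_iff)
qed

text \<open>Let \<open>s\<close> be the absolute value of \<open>x = a\<^sup>\<star> * a\<close>, so
  that \<open>n = s - x\<close> is twice the negative part of \<open>x\<close>, and let
  \<open>r\<close> be the root of \<open>s\<close>. Then \<open>a * n\<close> multiplied on the left
  by its star is minus the square of \<open>n * r\<close>, which
  \<open>negative_star_mult_eq_0\<close> forces to be 0. Hence \<open>n * s\<close> and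
  \<open>n * n\<close> vanish, and \<open>x = s\<close>.\<close>

lemma positive_star_mult: "positive (a\<^sup>\<star> * (a::'a::cstar_algebra))"
proof -
  define x where "x = a\<^sup>\<star> * a"
  have xsa: "x\<^sup>\<star> = x" by (simp add: x_def star_mult star_star)
  then have "positive (x * x)" by (auto simp: positive_def)
  then obtain s where s: "positive s" "s * s = x * x"
    and scomm: "\<forall>z. z * (x * x) = (x * x) * z \<longrightarrow> z * s = s * z"
    using positive_square_root by blast
  have xs: "x * s = s * x" by (rule scomm[rule_format]) (simp add: mult.assoc)
  obtain r where r: "positive r" "r * r = s"
    and rcomm: "\<forall>z. z * s = s * z \<longrightarrow> z * r = r * z"
    using positive_square_root[OF s(1)] by blast
  define n where "n = s - x"
  have nsa: "n\<^sup>\<star> = n" by (simp add: n_def star_diff xsa positive_star s)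
  have ns: "n * s = s * n" by (simp add: n_def algebra_simps xs)
  have nr: "n * r = r * n" by (rule rcomm[rule_format, OF ns])
  have nxn: "n * x = - (n * s)" by (simp add: n_def algebra_simps s(2) xs)
  have "n * n = n * s - n * x" unfolding n_def by (rule right_diff_distrib)
  then have nn: "n * n = 2 *\<^sub>R (n * s)" using nxn by (simp add: scaleR_2)
  have "(a * n)\<^sup>\<star> * (a * n) = n * x * n" by (simp add: star_mult nsa x_def mult.assoc)
  also have "\<dots> = - (n * (r * r) * n)" by (simp add: nxn r)
  also have "\<dots> = - ((n * r) * (n * r))" by (metis mult.assoc nr)
  finally have "n * r = 0"
    using negative_star_mult_eq_0[of "n * r" "a * n"] by (simp add: star_mult nsa positive_star r nr)
  then have "n * s = 0" by (metis r(2) mult.assoc mult_zero_left)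
  then have "n = 0" using nn nsa by (metis scaleR_zero_right star_mult_eq_0_iff)
  then show ?thesis using s(1) by (simp add: n_def x_def)
qed

lemma scaleC_one_eq_iff: "a *\<^sub>C 1 = b *\<^sub>C (1::'a::cstar_algebra) \<longleftrightarrow> a = b"
  by (simp add: complex_vector.scale_cancel_right)

text \<open>The scalar times 1 is a sum of positive elements, so \<open>c\<close> is self-conjugate.
  If it were negative, it and its opposite would both be positive with sum 0. If it is 0, each
  summand and the rest of the sum are positive with sum 0.\<close>

lemma sum_mult_star_scalar:
  fixes a :: "'i::finite \<Rightarrow> 'a::cstar_algebra"
  assumes c: "c *\<^sub>C 1 = (\<Sum>i\<in>UNIV. a i * (a i)\<^sup>\<star>)"
  shows "0 \<le> Re c" and "c = 0 \<Longrightarrow> a i = 0"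
proof -
  have p: "positive (a i * (a i)\<^sup>\<star>)" for i using positive_star_mult[of "(a i)\<^sup>\<star>"] by (simp add: star_star)
  then have pc: "positive (c *\<^sub>C (1::'a))" unfolding c by (intro positive_sum) 
  have "cnj c = c" using positive_star[OF pc] by (simp add: star_scaleC scaleC_one_eq_iff)
  then have cr: "c = complex_of_real (Re c)" by (simp add: complex_eq_iff)
  show "0 \<le> Re c"
  proof (rule ccontr)
    assume neg: "\<not> 0 \<le> Re c"
    have "positive (1::'a)" unfolding positive_def by (metis star_one mult.left_neutral)
    then have "positive ((- Re c) *\<^sub>R (1::'a))" using neg by (intro positive_scaleR) auto
    moreover have "c *\<^sub>C (1::'a) + (- Re c) *\<^sub>R 1 = 0"
      using cr by (simp add: scaleR_scaleC)
    ultimately have "c *\<^sub>C (1::'a) = 0" using positive_add_eq_0[OF pc] by blast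
    then show False using neg by simp
  qed
  show "a i = 0" if "c = 0"
  proof -
    have "(\<Sum>i\<in>UNIV. a i * (a i)\<^sup>\<star>) = a i * (a i)\<^sup>\<star> + (\<Sum>i\<in>UNIV - {i}. a i * (a i)\<^sup>\<star>)"
      by (rule sum.remove) simp_all
    then have "a i * (a i)\<^sup>\<star> = 0"
      using c that positive_add_eq_0[OF p positive_sum[OF p]] by simp
    then show ?thesis using star_mult_eq_0_iff[of "(a i)\<^sup>\<star>"] by (metis star_star star_zero)
  qed
qed

section \<open>Inner product spaces on subspaces\<close>

lemma clinear_iff:
  "clinear f \<longleftrightarrow> (\<forall>x y. f (x + y) = f x + f y) \<and> (\<forall>c x. f (c *\<^sub>C x) = c *\<^sub>C f x)"
  by (simp add: Vector_Spaces.linear_iff complex_vector.vector_space_axioms)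

lemma clinear_add: "clinear f \<Longrightarrow> f (x + y) = f x + f y"
  and clinear_scale: "clinear f \<Longrightarrow> f (c *\<^sub>C x) = c *\<^sub>C f x"
  by (simp_all add: clinear_iff)

lemma clinear_0: "clinear f \<Longrightarrow> f 0 = 0"
  using clinear_add[of f 0 0] by simp

lemma clinear_sum: "clinear f \<Longrightarrow> f (\<Sum>i\<in>I. x i) = (\<Sum>i\<in>I. f (x i))"
  by (induction I rule: infinite_finite_induct) (simp_all add: clinear_0 clinear_add)

lemma antilinear_add: "antilinear f \<Longrightarrow> f (x + y) = f x + f y"
  and antilinear_scale: "antilinear f \<Longrightarrow> f (c *\<^sub>C x) = cnj c *\<^sub>C f x"
  by (simp_all add: antilinear_def)

lemma antilinear_sum: "antilinear f \<Longrightarrow> f (\<Sum>i\<in>I. x i) = (\<Sum>i\<in>I. f (x i))"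
proof -
  assume f: "antilinear f"
  have "f 0 = 0" using antilinear_add[OF f, of 0 0] by simp
  then show ?thesis
    by (induction I rule: infinite_finite_induct) (simp_all add: antilinear_add f)
qed

text \<open>Spanning is left out on purpose: finite dimension is itself deduced from a bound on the
  size of such sets.\<close>

definition orthonormal :: "'v hspace \<Rightarrow> 'v set \<Rightarrow> bool"
  where "orthonormal H E \<longleftrightarrow> finite E \<and> E \<subseteq> hcarrier H \<and>
    (\<forall>x\<in>E. \<forall>y\<in>E. hinner H x y = (if x = y then 1 else 0))"

text \<open>The record \<open>hspace\<close> carries no laws, and the inner product of
  \<open>Lbar\<close> is a definite description that is meaningful on the carrier only; hence every
  law is relative to the carrier.\<close>

locale inner_product_space =
  fixes H :: "'v::complex_vector hspace"
  assumes subspace: "complex_vector.subspace (hcarrier H)"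
    and inner_add_right: "\<lbrakk>x \<in> hcarrier H; y \<in> hcarrier H; z \<in> hcarrier H\<rbrakk>
      \<Longrightarrow> hinner H x (y + z) = hinner H x y + hinner H x z"
    and inner_scale_right: "\<lbrakk>x \<in> hcarrier H; y \<in> hcarrier H\<rbrakk>
      \<Longrightarrow> hinner H x (c *\<^sub>C y) = c * hinner H x y"
    and inner_commute: "\<lbrakk>x \<in> hcarrier H; y \<in> hcarrier H\<rbrakk>
      \<Longrightarrow> hinner H x y = cnj (hinner H y x)"
    and inner_nonneg: "x \<in> hcarrier H \<Longrightarrow> 0 \<le> Re (hinner H x x)"
    and inner_eq_0D: "x \<in> hcarrier H \<Longrightarrow> hinner H x x = 0 \<Longrightarrow> x = 0"
begin

lemma carrier_0: "0 \<in> hcarrier H"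
  and carrier_add: "x \<in> hcarrier H \<Longrightarrow> y \<in> hcarrier H \<Longrightarrow> x + y \<in> hcarrier H"
  and carrier_scale: "x \<in> hcarrier H \<Longrightarrow> c *\<^sub>C x \<in> hcarrier H"
  and carrier_diff: "x \<in> hcarrier H \<Longrightarrow> y \<in> hcarrier H \<Longrightarrow> x - y \<in> hcarrier H"
  and carrier_sum: "(\<And>i. i \<in> I \<Longrightarrow> f i \<in> hcarrier H) \<Longrightarrow> (\<Sum>i\<in>I. f i) \<in> hcarrier H"
  using subspace by (simp_all add: complex_vector.subspace_0 complex_vector.subspace_add
    complex_vector.subspace_scale complex_vector.subspace_diff complex_vector.subspace_sum)

lemma inner_0_right: "x \<in> hcarrier H \<Longrightarrow> hinner H x 0 = 0"
  using inner_add_right[of x 0 0] by (simp add: carrier_0)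

lemma inner_sum_right:
  assumes "x \<in> hcarrier H" "\<And>i. i \<in> I \<Longrightarrow> f i \<in> hcarrier H"
  shows "hinner H x (\<Sum>i\<in>I. f i) = (\<Sum>i\<in>I. hinner H x (f i))"
  using assms(2)
  by (induction I rule: infinite_finite_induct)
    (simp_all add: inner_0_right inner_add_right carrier_sum assms(1))

lemma inner_sum_left:
  assumes "x \<in> hcarrier H" "\<And>i. i \<in> I \<Longrightarrow> f i \<in> hcarrier H"
  shows "hinner H (\<Sum>i\<in>I. f i) x = (\<Sum>i\<in>I. hinner H (f i) x)"
proof -
  have "hinner H (\<Sum>i\<in>I. f i) x = cnj (hinner H x (\<Sum>i\<in>I. f i))"
    using assms by (intro inner_commute carrier_sum)
  also have "\<dots> = (\<Sum>i\<in>I. cnj (hinner H x (f i)))"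
    using assms by (simp add: inner_sum_right)
  also have "\<dots> = (\<Sum>i\<in>I. hinner H (f i) x)"
    using assms by (intro sum.cong) (auto simp: inner_commute[of x])
  finally show ?thesis .
qed

lemma inner_scale_left:
  "x \<in> hcarrier H \<Longrightarrow> y \<in> hcarrier H \<Longrightarrow> hinner H (c *\<^sub>C y) x = cnj c * hinner H y x"
  by (metis carrier_scale complex_cnj_mult inner_commute inner_scale_right)

lemma inner_diff_right:
  assumes "x \<in> hcarrier H" "y \<in> hcarrier H" "z \<in> hcarrier H"
  shows "hinner H x (y - z) = hinner H x y - hinner H x z"
  using inner_add_right[of x "y - z" z] assms by (simp add: carrier_diff)

lemma inner_diff_left:
  assumes "x \<in> hcarrier H" "y \<in> hcarrier H" "z \<in> hcarrier H"
  shows "hinner H (y - z) x = hinner H y x - hinner H z x"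
  by (metis assms carrier_diff complex_cnj_diff inner_commute inner_diff_right)

lemma inner_self_real: "x \<in> hcarrier H \<Longrightarrow> hinner H x x = complex_of_real (Re (hinner H x x))"
  using inner_commute[of x x] by (auto simp: complex_eq_iff)

lemma eq_if_inner_eq:
  assumes "x \<in> hcarrier H" "y \<in> hcarrier H"
    and "\<And>z. z \<in> hcarrier H \<Longrightarrow> hinner H x z = hinner H y z"
  shows "x = y"
proof -
  have "hinner H (x - y) (x - y) = 0" using assms by (simp add: inner_diff_left carrier_diff)
  then show ?thesis using inner_eq_0D[of "x - y"] assms by (simp add: carrier_diff)
qed

lemma onb_orthonormal: "orthonormal_basis H E \<Longrightarrow> orthonormal H E"
  unfolding orthonormal_basis_def orthonormal_def by (metis complex_vector.span_superset)

lemma onb_finite: "orthonormal_basis H E \<Longrightarrow> finite E"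
  and onb_carrier: "orthonormal_basis H E \<Longrightarrow> e \<in> E \<Longrightarrow> e \<in> hcarrier H"
  and onb_inner: "orthonormal_basis H E \<Longrightarrow> e \<in> E \<Longrightarrow> f \<in> E
    \<Longrightarrow> hinner H e f = (if e = f then 1 else 0)"
  using onb_orthonormal unfolding orthonormal_def by blast+

lemma inner_orthonormal_sum:
  assumes E: "orthonormal H E" and e: "e \<in> E"
  shows "hinner H e (\<Sum>f\<in>E. c f *\<^sub>C f) = c e"
proof -
  have car: "f \<in> hcarrier H" if "f \<in> E" for f using E that by (auto simp: orthonormal_def)
  have "hinner H e (\<Sum>f\<in>E. c f *\<^sub>C f) = (\<Sum>f\<in>E. c f * hinner H e f)"
    using e by (subst inner_sum_right) (auto simp: car carrier_scale inner_scale_right)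
  also have "\<dots> = (\<Sum>f\<in>E. if e = f then c f else 0)"
    using E e by (intro sum.cong) (auto simp: orthonormal_def)
  also have "\<dots> = c e" using E e by (simp add: orthonormal_def)
  finally show ?thesis .
qed

lemma onb_expansion:
  assumes E: "orthonormal_basis H E" and x: "x \<in> hcarrier H"
  shows "x = (\<Sum>e\<in>E. hinner H e x *\<^sub>C e)"
proof -
  have "x \<in> cspan E" "finite E" using assms by (auto simp: orthonormal_basis_def)
  then obtain c where c: "x = (\<Sum>e\<in>E. c e *\<^sub>C e)"
    by (auto simp: complex_vector.span_finite)
  have "hinner H e x = c e" if "e \<in> E" for e
    unfolding c by (rule inner_orthonormal_sum[OF onb_orthonormal[OF E] that])
  then have "(\<Sum>e\<in>E. hinner H e x *\<^sub>C e) = (\<Sum>e\<in>E. c e *\<^sub>C e)" by simp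
  then show ?thesis using c by simp
qed

lemma parseval:
  assumes E: "orthonormal_basis H E" and x: "x \<in> hcarrier H" and y: "y \<in> hcarrier H"
  shows "hinner H x y = (\<Sum>e\<in>E. hinner H x e * hinner H e y)"
proof -
  have "hinner H x y = hinner H x (\<Sum>e\<in>E. hinner H e y *\<^sub>C e)"
    using onb_expansion[OF E y] by simp
  also have "\<dots> = (\<Sum>e\<in>E. hinner H e y * hinner H x e)"
    using x by (subst inner_sum_right)
      (auto simp: carrier_scale onb_carrier[OF E] inner_scale_right)
  finally show ?thesis by (simp add: mult.commute)
qed

text \<open>The bound provides an orthonormal set of largest cardinality. If it did not span, one
  Gram-Schmidt step would enlarge it.\<close>

lemma ex_orthonormal_basis:
  assumes bound: "\<And>E. orthonormal H E \<Longrightarrow> card E \<le> N"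
  shows "\<exists>E. orthonormal_basis H E"
proof -
  have "orthonormal H {}" by (simp add: orthonormal_def)
  then obtain E where E: "orthonormal H E"
    and max: "\<And>F. orthonormal H F \<Longrightarrow> card F \<le> card E"
    using ex_has_greatest_nat[of "orthonormal H" "{}" card "Suc N"] bound
    by (metis le_imp_less_Suc)
  have car: "f \<in> hcarrier H" if "f \<in> E" for f using E that by (auto simp: orthonormal_def)
  have "x \<in> cspan E" if x: "x \<in> hcarrier H" for x
  proof (rule ccontr)
    assume nx: "x \<notin> cspan E"
    \<comment> \<open>The orthogonal projection of \<open>x\<close> onto the span of
      \<open>E\<close>; the normalised remainder is the new vector.\<close>
    define p where "p = (\<Sum>e\<in>E. hinner H e x *\<^sub>C e)"
    define y where "y = x - p"
    have p: "p \<in> hcarrier H" unfolding p_def by (intro carrier_sum carrier_scale car)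
    have "p \<in> cspan E"
      unfolding p_def by (intro complex_vector.span_sum complex_vector.span_scale complex_vector.span_base)
    have y: "y \<in> hcarrier H" unfolding y_def using x p by (simp add: carrier_diff)
    have "y \<noteq> 0" using nx \<open>p \<in> cspan E\<close> unfolding y_def by auto
    then have "hinner H y y \<noteq> 0" using inner_eq_0D y by blast
    define r where "r = Re (hinner H y y)"
    have r: "hinner H y y = complex_of_real r" unfolding r_def by (rule inner_self_real[OF y])
    then have "r > 0" using \<open>hinner H y y \<noteq> 0\<close> inner_nonneg[OF y] by (cases "r = 0") (auto simp: r_def)
    define z where "z = complex_of_real (inverse (sqrt r)) *\<^sub>C y"
    have z: "z \<in> hcarrier H" unfolding z_def by (rule carrier_scale[OF y])
    have "hinner H z z = complex_of_real (inverse (sqrt r) * inverse (sqrt r) * r)"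
      unfolding z_def by (simp add: inner_scale_left inner_scale_right y carrier_scale r)
    also have "inverse (sqrt r) * inverse (sqrt r) * r = 1"
      using \<open>r > 0\<close> by (simp add: field_simps)
    finally have zz: "hinner H z z = 1" by simp
    have ez: "hinner H e z = 0" if "e \<in> E" for e
    proof -
      have "hinner H e y = 0"
        unfolding y_def using that inner_orthonormal_sum[OF E that, of "\<lambda>f. hinner H f x"]
        by (simp add: inner_diff_right car x p flip: p_def)
      then show ?thesis unfolding z_def using that by (simp add: inner_scale_right car y)
    qed
    have ze: "hinner H z e = 0" if "e \<in> E" for e
      using ez[OF that] inner_commute[OF z car[OF that]] by simp
    have "z \<notin> E" using zz ez by fastforce
    moreover have "orthonormal H (insert z E)"
      using E z zz ez ze \<open>z \<notin> E\<close> unfolding orthonormal_def by auto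
    ultimately show False using max[of "insert z E"] E by (simp add: orthonormal_def)
  qed
  moreover have "cspan E \<subseteq> hcarrier H"
    using complex_vector.span_minimal[of E "hcarrier H"] car subspace by blast
  ultimately show ?thesis
    using E unfolding orthonormal_basis_def orthonormal_def by blast
qed

end

section \<open>Tensor products\<close>

locale inner_product_space_pair = H: inner_product_space H + K: inner_product_space K
  for H :: "'v::complex_vector hspace" and K :: "'w::complex_vector hspace"
begin

lemma tens_scale_left:
  "v \<in> hcarrier H \<Longrightarrow> tens H K (c *\<^sub>C v) w = c *\<^sub>C tens H K v w"
  by (auto simp: fun_eq_iff tens_def scaleC_fun_def scaleC_complex_def H.inner_scale_right)

lemma sum_list_tens_apply:
  "(\<Sum>(v, w)\<leftarrow>xs. tens H K v w) p = (\<Sum>(v, w)\<leftarrow>xs. tens H K v w p)"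
  by (induction xs) auto

text \<open>Lists without coefficients suffice because a scalar can be absorbed into the left
  factor.\<close>

lemma ex_tens_repr:
  assumes "x \<in> hcarrier (tens_space H K)"
  shows "\<exists>xs. tens_repr H K xs x"
proof -
  have "x \<in> cspan {tens H K v w | v w. v \<in> hcarrier H \<and> w \<in> hcarrier K}"
    using assms by (simp add: tens_space_def)
  then show ?thesis
  proof (induction rule: complex_vector.span_induct_alt)
    case base
    show ?case by (rule exI[of _ "[]"]) (simp add: tens_repr_def fun_eq_iff)
  next
    case (step c t y)
    then obtain v w xs where "v \<in> hcarrier H" "w \<in> hcarrier K" "t = tens H K v w"
      "tens_repr H K xs y" by blast
    then have "tens_repr H K ((c *\<^sub>C v, w) # xs) (c *\<^sub>C t + y)"
      by (simp add: tens_repr_def H.carrier_scale tens_scale_left)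
    then show ?case by blast
  qed
qed

lemma tens_carrier:
  "v \<in> hcarrier H \<Longrightarrow> w \<in> hcarrier K \<Longrightarrow> tens H K v w \<in> hcarrier (tens_space H K)"
  by (auto simp: tens_space_def intro!: complex_vector.span_base)

lemma tens_sum_carrier:
  assumes "\<And>i. i \<in> I \<Longrightarrow> v i \<in> hcarrier H" "\<And>i. i \<in> I \<Longrightarrow> w i \<in> hcarrier K"
  shows "(\<Sum>i\<in>I. tens H K (v i) (w i)) \<in> hcarrier (tens_space H K)"
  using tens_carrier assms by (auto simp: tens_space_def intro!: complex_vector.span_sum)

definition list_inner :: "('v \<times> 'w) list \<Rightarrow> ('v \<times> 'w) list \<Rightarrow> complex"
  where "list_inner xs ys = (\<Sum>(v, w)\<leftarrow>xs. \<Sum>(v', w')\<leftarrow>ys. hinner H v v' * hinner K w w')"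

text \<open>A tensor is encoded as the form giving its inner products with elementary tensors. The
  inner sum is thus a value of \<open>y\<close>, so the choice of \<open>ys\<close> does not
  matter.\<close>

lemma list_inner_right:
  assumes "set xs \<subseteq> hcarrier H \<times> hcarrier K" "tens_repr H K ys y"
  shows "list_inner xs ys = (\<Sum>p\<leftarrow>xs. y p)"
proof -
  have "(\<Sum>(v', w')\<leftarrow>ys. hinner H v v' * hinner K w w') = y (v, w)" if "(v, w) \<in> set xs" for v w
  proof -
    have "v \<in> hcarrier H" "w \<in> hcarrier K" using assms(1) that by auto
    moreover have "y (v, w) = (\<Sum>(v', w')\<leftarrow>ys. tens H K v' w' (v, w))"
      using assms(2) by (simp add: tens_repr_def sum_list_tens_apply)
    ultimately show ?thesis by (simp add: tens_def)
  qed
  then show ?thesis unfolding list_inner_def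
    by (intro arg_cong[of _ _ sum_list] map_cong) auto
qed

lemma list_inner_commute:
  assumes "set xs \<subseteq> hcarrier H \<times> hcarrier K" "set ys \<subseteq> hcarrier H \<times> hcarrier K"
  shows "list_inner xs ys = cnj (list_inner ys xs)"
proof -
  have cnj_sum: "cnj (\<Sum>p\<leftarrow>l. g p) = (\<Sum>p\<leftarrow>l. cnj (g p))" for l and g :: "'v \<times> 'w \<Rightarrow> complex"
    by (induction l) auto
  have swap: "(\<Sum>p\<leftarrow>l. \<Sum>q\<leftarrow>m. g p q) = (\<Sum>q\<leftarrow>m. \<Sum>p\<leftarrow>l. g p q)"
    for l m and g :: "'v \<times> 'w \<Rightarrow> 'v \<times> 'w \<Rightarrow> complex"
    by (induction l) (simp_all add: sum_list_addf)
  let ?g = "\<lambda>p q. hinner H (fst p) (fst q) * hinner K (snd p) (snd q)"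
  have "list_inner xs ys = (\<Sum>p\<leftarrow>xs. \<Sum>q\<leftarrow>ys. ?g p q)"
    by (simp add: list_inner_def case_prod_beta')
  also have "\<dots> = (\<Sum>p\<leftarrow>xs. \<Sum>q\<leftarrow>ys. cnj (?g q p))"
  proof (intro arg_cong[of _ _ sum_list] map_cong refl)
    fix p q assume "p \<in> set xs" "q \<in> set ys"
    then have "fst p \<in> hcarrier H" "snd p \<in> hcarrier K" "fst q \<in> hcarrier H" "snd q \<in> hcarrier K"
      using assms by auto
    then show "?g p q = cnj (?g q p)" by (simp flip: H.inner_commute K.inner_commute)
  qed
  also have "\<dots> = cnj (list_inner ys xs)"
    by (simp add: list_inner_def case_prod_beta' cnj_sum swap[of _ xs ys])
  finally show ?thesis .
qed

text \<open>Independence of the right representation is \<open>list_inner_right\<close>; conjugate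
  symmetry transfers it to the left one, so the definite description has a unique solution.\<close>

lemma inner_tens_repr:
  assumes x: "tens_repr H K xs x" and y: "tens_repr H K ys y"
  shows "hinner (tens_space H K) x y = list_inner xs ys"
proof -
  have uniq: "list_inner xs' ys' = list_inner xs ys"
    if "tens_repr H K xs' x" "tens_repr H K ys' y" for xs' ys'
  proof -
    have sets: "set xs \<subseteq> hcarrier H \<times> hcarrier K" "set ys \<subseteq> hcarrier H \<times> hcarrier K"
      "set xs' \<subseteq> hcarrier H \<times> hcarrier K"
      using that(1) x y by (simp_all add: tens_repr_def)
    have "list_inner xs' ys' = list_inner xs' ys"
      unfolding list_inner_right[OF sets(3) that(2)] list_inner_right[OF sets(3) y] ..
    also have "\<dots> = cnj (list_inner ys xs')" by (rule list_inner_commute[OF sets(3,2)])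
    also have "\<dots> = cnj (list_inner ys xs)"
      unfolding list_inner_right[OF sets(2) that(1)] list_inner_right[OF sets(2) x] ..
    also have "\<dots> = list_inner xs ys" by (rule list_inner_commute[OF sets(1,2), symmetric])
    finally show ?thesis .
  qed
  show ?thesis
    unfolding tens_space_def hspace.select_convs list_inner_def[symmetric]
    using x y uniq by (intro the_equality) blast+
qed

lemma inner_tens_tens:
  assumes x: "x \<in> hcarrier (tens_space H K)" and v: "v \<in> hcarrier H" and w: "w \<in> hcarrier K"
  shows "hinner (tens_space H K) x (tens H K v w) = cnj (x (v, w))"
proof -
  obtain xs where xs: "tens_repr H K xs x" using ex_tens_repr[OF x] by blast
  have vw: "tens_repr H K [(v, w)] (tens H K v w)" using v w by (simp add: tens_repr_def)
  have sets: "set xs \<subseteq> hcarrier H \<times> hcarrier K" "set [(v, w)] \<subseteq> hcarrier H \<times> hcarrier K"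
    using xs v w by (auto simp: tens_repr_def)
  have "hinner (tens_space H K) x (tens H K v w) = cnj (list_inner [(v, w)] xs)"
    by (simp only: inner_tens_repr[OF xs vw] list_inner_commute[OF sets])
  then show ?thesis by (simp add: list_inner_right[OF sets(2) xs])
qed

lemma tens_eqI:
  assumes x: "x \<in> hcarrier (tens_space H K)" and y: "y \<in> hcarrier (tens_space H K)"
    and eq: "\<And>v w. v \<in> hcarrier H \<Longrightarrow> w \<in> hcarrier K \<Longrightarrow>
      hinner (tens_space H K) x (tens H K v w) = hinner (tens_space H K) y (tens H K v w)"
  shows "x = y"
proof
  \<comment> \<open>The default value 0 in \<open>tens\<close> makes \<open>x\<close> and
    \<open>y\<close> agree outside the carriers, as equality of functions demands.\<close>
  have out: "z p = 0" if z: "z \<in> hcarrier (tens_space H K)" and p: "p \<notin> hcarrier H \<times> hcarrier K" for z p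
  proof -
    obtain zs where "tens_repr H K zs z" using ex_tens_repr[OF z] by blast
    then have "z p = (\<Sum>(v, w)\<leftarrow>zs. tens H K v w p)"
      by (simp add: tens_repr_def sum_list_tens_apply)
    moreover have "tens H K v w p = 0" for v w using p by (auto simp: tens_def split: prod.split)
    ultimately show ?thesis by (simp add: case_prod_beta')
  qed
  fix p show "x p = y p"
    using out[OF x, of p] out[OF y, of p] eq[of "fst p" "snd p"] x y
    by (cases "p \<in> hcarrier H \<times> hcarrier K") (auto simp: inner_tens_tens)
qed

text \<open>Expanding both factors in bases turns \<open>f v w\<close> into a combination of the
  \<open>f a b\<close> whose coefficients are values of the form \<open>tens H K v w\<close>. The
  sum over a list therefore depends only on the tensor it represents.\<close>

lemma tens_lift_repr:
  assumes E: "orthonormal_basis H E" and F: "orthonormal_basis K F"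
    and f1: "\<And>w. clinear (\<lambda>v. f v w)" and f2: "\<And>v. clinear (f v)"
    and x: "tens_repr H K xs x"
  shows "tens_lift H K f x = (\<Sum>(v, w)\<leftarrow>xs. f v w)"
proof -
  have elem: "f v w = (\<Sum>a\<in>E. \<Sum>b\<in>F. tens H K v w (a, b) *\<^sub>C f a b)"
    if "v \<in> hcarrier H" "w \<in> hcarrier K" for v w
  proof -
    have "f v w = f (\<Sum>a\<in>E. hinner H a v *\<^sub>C a) (\<Sum>b\<in>F. hinner K b w *\<^sub>C b)"
      using H.onb_expansion[OF E that(1)] K.onb_expansion[OF F that(2)] by simp
    also have "\<dots> = (\<Sum>b\<in>F. \<Sum>a\<in>E. hinner K b w *\<^sub>C hinner H a v *\<^sub>C f a b)"
      by (simp only: clinear_sum[OF f1] clinear_sum[OF f2] clinear_scale[OF f1] clinear_scale[OF f2]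
          complex_vector.scale_sum_right)
    also have "\<dots> = (\<Sum>a\<in>E. \<Sum>b\<in>F. hinner K b w *\<^sub>C hinner H a v *\<^sub>C f a b)"
      by (rule sum.swap)
    finally show ?thesis
      by (simp add: scaleC_scaleC tens_def H.onb_carrier[OF E] K.onb_carrier[OF F] mult.commute
          cong: sum.cong)
  qed
  have "(\<Sum>(v, w)\<leftarrow>ys. f v w)
      = (\<Sum>a\<in>E. \<Sum>b\<in>F. (\<Sum>(v, w)\<leftarrow>ys. tens H K v w) (a, b) *\<^sub>C f a b)"
    if "set ys \<subseteq> hcarrier H \<times> hcarrier K" for ys
    using that
    by (induction ys) (auto simp: elem scaleC_add_left sum.distrib)
  then have "(\<Sum>(v, w)\<leftarrow>ys. f v w) = (\<Sum>a\<in>E. \<Sum>b\<in>F. x (a, b) *\<^sub>C f a b)"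
    if "tens_repr H K ys x" for ys
    using that by (simp add: tens_repr_def)
  then show ?thesis unfolding tens_lift_def using x by (intro the_equality) auto
qed

text \<open>Since the candidate \<open>x\<close> is supplied, the adjoint identity has only to be
  tested on elementary tensors; it extends additively along representations, and
  \<open>tens_eqI\<close> gives uniqueness.\<close>

lemma hadjoint_tens_lift_eq:
  assumes L: "inner_product_space L"
    and E: "orthonormal_basis H E" and F: "orthonormal_basis K F"
    and f1: "\<And>w. clinear (\<lambda>v. f v w)" and f2: "\<And>v. clinear (f v)"
    and fL: "\<And>v w. v \<in> hcarrier H \<Longrightarrow> w \<in> hcarrier K \<Longrightarrow> f v w \<in> hcarrier L"
    and y: "y \<in> hcarrier L" and x: "x \<in> hcarrier (tens_space H K)"
    and eq: "\<And>v w. v \<in> hcarrier H \<Longrightarrow> w \<in> hcarrier K \<Longrightarrow>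
      hinner (tens_space H K) x (tens H K v w) = hinner L y (f v w)"
  shows "hadjoint (tens_space H K) L (tens_lift H K f) y = x"
proof -
  interpret L: inner_product_space L by (rule L)
  have gen: "hinner (tens_space H K) x z = hinner L y (tens_lift H K f z)"
    if z: "z \<in> hcarrier (tens_space H K)" for z
  proof -
    obtain zs where zs: "tens_repr H K zs z" using ex_tens_repr[OF z] by blast
    obtain xs where xs: "tens_repr H K xs x" using ex_tens_repr[OF x] by blast
    have x_eq: "cnj (x (v, w)) = hinner L y (f v w)" if "v \<in> hcarrier H" "w \<in> hcarrier K" for v w
      using eq[OF that] inner_tens_tens[OF x that] by simp
    have "list_inner xs ls = hinner L y (\<Sum>(v, w)\<leftarrow>ls. f v w) \<and> (\<Sum>(v, w)\<leftarrow>ls. f v w) \<in> hcarrier L"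
      if "set ls \<subseteq> hcarrier H \<times> hcarrier K" for ls
    proof -
      have 1: "list_inner xs ls = cnj (\<Sum>p\<leftarrow>ls. x p)"
        using that xs list_inner_right[OF that xs] list_inner_commute[of xs ls]
        by (simp add: tens_repr_def)
      have "cnj (\<Sum>p\<leftarrow>ls. x p) = hinner L y (\<Sum>(v, w)\<leftarrow>ls. f v w)
          \<and> (\<Sum>(v, w)\<leftarrow>ls. f v w) \<in> hcarrier L"
        using that
        by (induction ls)
          (auto simp: L.inner_0_right L.inner_add_right L.carrier_0 L.carrier_add y fL x_eq)
      then show ?thesis using 1 by simp
    qed
    moreover have "set zs \<subseteq> hcarrier H \<times> hcarrier K" using zs by (simp add: tens_repr_def)
    ultimately show ?thesis
      by (simp only: inner_tens_repr[OF xs zs] tens_lift_repr[OF E F f1 f2 zs])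
  qed
  show ?thesis
    unfolding hadjoint_def
  proof (rule the_equality)
    show "x' = x" if "x' \<in> hcarrier (tens_space H K) \<and> (\<forall>z\<in>hcarrier (tens_space H K).
        hinner (tens_space H K) x' z = hinner L y (tens_lift H K f z))" for x'
      using that x gen tens_carrier by (intro tens_eqI) auto
  qed (use x gen in blast)
qed

lemma inner_sum_tens_self:
  assumes F: "orthonormal_basis K F" and g: "\<And>f. f \<in> F \<Longrightarrow> g f \<in> hcarrier H"
  defines "x \<equiv> \<Sum>f\<in>F. tens H K (g f) f"
  shows "hinner (tens_space H K) x x = (\<Sum>f\<in>F. hinner H (g f) (g f))"
proof -
  have fin: "finite F" by (rule K.onb_finite[OF F])
  obtain l where l: "set l = F" "distinct l" using finite_distinct_list[OF fin] by blast
  let ?xs = "map (\<lambda>f. (g f, f)) l"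
  have sum_l: "(\<Sum>f\<leftarrow>l. h f) = (\<Sum>f\<in>F. h f)" for h :: "'w \<Rightarrow> 'z::comm_monoid_add"
    using l by (simp add: sum_list_distinct_conv_sum_set)
  have repr: "tens_repr H K ?xs x"
    using l g K.onb_carrier[OF F] by (auto simp: tens_repr_def x_def comp_def sum_l)
  have "hinner (tens_space H K) x x = (\<Sum>e\<in>F. \<Sum>f\<in>F. hinner H (g e) (g f) * hinner K e f)"
    unfolding inner_tens_repr[OF repr repr] list_inner_def by (simp add: comp_def sum_l)
  also have "\<dots> = (\<Sum>e\<in>F. \<Sum>f\<in>F. if e = f then hinner H (g e) (g f) else 0)"
    by (intro sum.cong refl) (auto simp: K.onb_inner[OF F])
  finally show ?thesis using fin by simp
qed

end

section \<open>Traces of antilinear operators\<close>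

context inner_product_space_pair
begin

text \<open>The basis gives an explicit vector with the adjoint property, so the definite
  description is not void.\<close>

lemma antilinear_adjoint:
  assumes E: "orthonormal_basis H E" and J: "antilinear J"
    and JK: "\<forall>x\<in>hcarrier H. J x \<in> hcarrier K" and y: "y \<in> hcarrier K"
  shows "antilinear_adjoint H K J y \<in> hcarrier H"
    and "z \<in> hcarrier H \<Longrightarrow> hinner K (J z) y = hinner H (antilinear_adjoint H K J y) z"
proof -
  define x where "x = (\<Sum>e\<in>E. hinner K y (J e) *\<^sub>C e)"
  have x: "x \<in> hcarrier H" unfolding x_def
    by (intro H.carrier_sum H.carrier_scale H.onb_carrier[OF E])
  have xz: "hinner K (J z) y = hinner H x z" if z: "z \<in> hcarrier H" for z
  proof -
    have "J z = J (\<Sum>e\<in>E. hinner H e z *\<^sub>C e)" using H.onb_expansion[OF E z] by simp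
    also have "\<dots> = (\<Sum>e\<in>E. cnj (hinner H e z) *\<^sub>C J e)"
      by (simp add: antilinear_sum[OF J] antilinear_scale[OF J])
    finally have "hinner K (J z) y = (\<Sum>e\<in>E. hinner H e z * hinner K (J e) y)"
      by (simp add: K.inner_sum_left y K.carrier_scale JK H.onb_carrier[OF E] K.inner_scale_left)
    also have "\<dots> = (\<Sum>e\<in>E. cnj (hinner K y (J e)) * hinner H e z)"
      by (intro sum.cong refl) (simp add: K.inner_commute[of _ y] y JK H.onb_carrier[OF E])
    also have "\<dots> = hinner H x z"
      unfolding x_def
      by (simp add: H.inner_sum_left z H.carrier_scale H.onb_carrier[OF E] H.inner_scale_left)
    finally show ?thesis .
  qed
  have "antilinear_adjoint H K J y = x"
    unfolding antilinear_adjoint_def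
    by (rule the_equality) (use x xz H.eq_if_inner_eq in metis)+
  then show "antilinear_adjoint H K J y \<in> hcarrier H"
    and "z \<in> hcarrier H \<Longrightarrow> hinner K (J z) y = hinner H (antilinear_adjoint H K J y) z"
    using x xz by simp_all
qed

text \<open>Both sides are the squared norm of the adjoint applied to \<open>y\<close>, the right
  one by Parseval.\<close>

lemma inner_antilinear_adjoint_self:
  assumes E: "orthonormal_basis H E" and J: "antilinear J"
    and JK: "\<forall>x\<in>hcarrier H. J x \<in> hcarrier K" and y: "y \<in> hcarrier K"
  shows "hinner K y (J (antilinear_adjoint H K J y)) = (\<Sum>e\<in>E. hinner K (J e) y * hinner K y (J e))"
proof -
  let ?x = "antilinear_adjoint H K J y"
  note adj = antilinear_adjoint[OF E J JK y]
  have "hinner K y (J ?x) = cnj (hinner K (J ?x) y)" using y JK adj by (intro K.inner_commute) auto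
  also have "\<dots> = hinner H ?x ?x" using adj by (simp flip: H.inner_commute)
  also have "\<dots> = (\<Sum>e\<in>E. hinner H ?x e * hinner H e ?x)" by (rule H.parseval[OF E adj(1) adj(1)])
  also have "\<dots> = (\<Sum>e\<in>E. hinner K (J e) y * hinner K y (J e))"
  proof (intro sum.cong refl)
    fix e assume "e \<in> E"
    then have e: "e \<in> hcarrier H" by (rule H.onb_carrier[OF E])
    show "hinner H ?x e * hinner H e ?x = hinner K (J e) y * hinner K y (J e)"
      using H.inner_commute[OF e adj(1)] K.inner_commute[OF y bspec[OF JK e]] adj(2)[OF e] by simp
  qed
  finally show ?thesis .
qed

text \<open>The trace is the squared Hilbert-Schmidt norm of \<open>J\<close>: exchange the sums
  over the two bases and apply Parseval in \<open>K\<close>.\<close>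

lemma htrace_antilinear:
  assumes E: "orthonormal_basis H E" and F: "orthonormal_basis K F" and J: "antilinear J"
    and JK: "\<forall>x\<in>hcarrier H. J x \<in> hcarrier K"
  shows "htrace K (J \<circ> antilinear_adjoint H K J) = (\<Sum>e\<in>E. hinner K (J e) (J e))"
proof -
  define F' where "F' = (SOME F. orthonormal_basis K F)"
  have F': "orthonormal_basis K F'" unfolding F'_def using F by (rule someI)
  have "htrace K (J \<circ> antilinear_adjoint H K J)
      = (\<Sum>f\<in>F'. \<Sum>e\<in>E. hinner K (J e) f * hinner K f (J e))"
    unfolding htrace_def F'_def[symmetric]
    by (intro sum.cong refl) (simp add: inner_antilinear_adjoint_self[OF E J JK] K.onb_carrier[OF F'])
  also have "\<dots> = (\<Sum>e\<in>E. \<Sum>f\<in>F'. hinner K (J e) f * hinner K f (J e))" by (rule sum.swap)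
  also have "\<dots> = (\<Sum>e\<in>E. hinner K (J e) (J e))"
  proof (intro sum.cong refl)
    fix e assume "e \<in> E"
    then have "J e \<in> hcarrier K" using JK H.onb_carrier[OF E] by blast
    then show "(\<Sum>f\<in>F'. hinner K (J e) f * hinner K f (J e)) = hinner K (J e) (J e)"
      using K.parseval[OF F', of "J e" "J e"] by simp
  qed
  finally show ?thesis .
qed

text \<open>Adjoints reverse products, so the adjoint of \<open>M\<close> inverts that of
  \<open>J\<close>. The inverse of \<open>J\<close> after its adjoint is then the adjoint of
  \<open>M\<close> after \<open>M\<close>, with trace the sum of the squared norms of
  \<open>M f\<close>. \<open>F\<close> is the choice made inside \<open>htrace\<close>, so this
  trace involves no change of basis.\<close>

lemma q_mult_eq:
  assumes E: "orthonormal_basis H E" and ex: "\<exists>F. orthonormal_basis K F"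
    and J: "antilinear J" and JK: "\<forall>x\<in>hcarrier H. J x \<in> hcarrier K"
    and M: "antilinear M" and MH: "\<forall>y\<in>hcarrier K. M y \<in> hcarrier H"
    and MJ: "\<And>x. x \<in> hcarrier H \<Longrightarrow> M (J x) = x" and JM: "\<And>y. y \<in> hcarrier K \<Longrightarrow> J (M y) = y"
  defines "F \<equiv> SOME F. orthonormal_basis K F"
  shows "q_mult H K J
    = sqrt (Re ((\<Sum>e\<in>E. hinner K (J e) (J e)) * (\<Sum>f\<in>F. hinner H (M f) (M f))))"
proof -
  interpret KH: inner_product_space_pair K H ..
  have F: "orthonormal_basis K F" unfolding F_def using ex by (rule someI_ex)
  let ?J' = "antilinear_adjoint H K J" and ?M' = "antilinear_adjoint K H M"
  note J' = antilinear_adjoint[OF E J JK] and M' = KH.antilinear_adjoint[OF F M MH]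
  have J'M': "?J' (?M' x) = x" if x: "x \<in> hcarrier H" for x
  proof (rule H.eq_if_inner_eq)
    fix z assume z: "z \<in> hcarrier H"
    have "hinner H (?J' (?M' x)) z = hinner K (J z) (?M' x)" using J' M' x z by simp
    also have "\<dots> = cnj (hinner K (?M' x) (J z))" using M' x z JK by (intro K.inner_commute) auto
    also have "\<dots> = cnj (hinner H (M (J z)) x)" using M' x z JK by simp
    also have "\<dots> = hinner H x z" using MJ x z by (simp flip: H.inner_commute)
    finally show "hinner H (?J' (?M' x)) z = hinner H x z" .
  qed (use J' M' x in auto)
  have M'J': "?M' (?J' y) = y" if y: "y \<in> hcarrier K" for y
  proof (rule K.eq_if_inner_eq)
    fix z assume z: "z \<in> hcarrier K"
    have "hinner K (?M' (?J' y)) z = hinner H (M z) (?J' y)" using J' M' y z by simp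
    also have "\<dots> = cnj (hinner H (?J' y) (M z))" using J' y z MH by (intro H.inner_commute) auto
    also have "\<dots> = cnj (hinner K (J (M z)) y)" using J' y z MH by simp
    also have "\<dots> = hinner K y z" using JM y z by (simp flip: K.inner_commute)
    finally show "hinner K (?M' (?J' y)) z = hinner K y z" .
  qed (use J' M' y in auto)
  let ?Q = "J \<circ> ?J'"
  have inj: "inj_on ?Q (hcarrier K)"
    by (rule inj_on_inverseI[where g = "?M' \<circ> M"]) (simp add: MJ J' M'J')
  have inv: "inv_into (hcarrier K) ?Q y = ?M' (M y)" if "y \<in> hcarrier K" for y
    using that M' MH by (intro inv_into_f_eq[OF inj]) (auto simp: J'M' JM)
  have "htrace K (inv_into (hcarrier K) ?Q) = (\<Sum>f\<in>F. hinner H (M f) (M f))"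
    unfolding htrace_def F_def[symmetric]
  proof (intro sum.cong refl)
    fix f assume "f \<in> F"
    then have f: "f \<in> hcarrier K" by (rule K.onb_carrier[OF F])
    have "hinner K f (?M' (M f)) = cnj (hinner K (?M' (M f)) f)"
      using f M' MH by (intro K.inner_commute) auto
    also have "\<dots> = cnj (hinner H (M f) (M f))" using f M' MH by simp
    finally show "hinner K f (inv_into (hcarrier K) ?Q f) = hinner H (M f) (M f)"
      using f MH by (simp add: inv flip: H.inner_commute)
  qed
  then show ?thesis
    unfolding q_mult_def Let_def using htrace_antilinear[OF E F J JK] by simp
qed

end

section \<open>Coordinates\<close>

lemma scaleC_nth [simp]: "(c *\<^sub>C x) $ i = c *\<^sub>C (x $ i)"
  by (simp add: scaleC_vec_def)

lemma scaleC_complex [simp]: "c *\<^sub>C (z::complex) = c * z"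
  by (simp add: scaleC_complex_def)

lemma sum_UNIV_prod:
  "(\<Sum>p\<in>UNIV. f p) = (\<Sum>i\<in>UNIV. \<Sum>k\<in>UNIV. f (i::'i::finite, k::'k::finite))"
  by (simp add: sum.cartesian_product flip: UNIV_Times_UNIV)

lemma sum_stdb [simp]:
  fixes f :: "'n::finite \<Rightarrow> 'v::complex_vector"
  shows "(\<Sum>i\<in>UNIV. stdb j $ i *\<^sub>C f i) = f j"
proof -
  have "(\<Sum>i\<in>UNIV. stdb j $ i *\<^sub>C f i) = (\<Sum>i\<in>UNIV. if i = j then f i else 0)"
    by (intro sum.cong refl) (simp add: axis_def scaleC_one)
  then show ?thesis by simp
qed

lemma sum_mult_stdb [simp]: "(\<Sum>p\<in>UNIV. f p * stdb p $ k) = (f k :: complex)"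
proof -
  have "(\<Sum>p\<in>UNIV. f p * stdb p $ k) = (\<Sum>p\<in>UNIV. stdb k $ p *\<^sub>C f p)"
    by (intro sum.cong refl) (simp add: axis_def)
  then show ?thesis by (simp only: sum_stdb)
qed

lemma vec_expansion: "x = (\<Sum>i\<in>UNIV. x $ i *\<^sub>C stdb i)" for x :: "complex ^ 'n"
  by (simp add: vec_eq_iff axis_def if_distrib cong: if_cong)

lemma clinear_vec: "clinear A \<Longrightarrow> A x = (\<Sum>i\<in>UNIV. x $ i *\<^sub>C A (stdb i))"
  by (subst vec_expansion) (simp add: clinear_sum clinear_scale)

lemma antilinear_vec: "antilinear A \<Longrightarrow> A x = (\<Sum>i\<in>UNIV. cnj (x $ i) *\<^sub>C A (stdb i))"
  by (subst vec_expansion) (simp add: antilinear_sum antilinear_scale)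

lemma vtens_nth [simp]: "vtens x y $ (i, k) = x $ i * y $ k"
  by (simp add: vtens_def)

lemma hadjoint_Cn:
  fixes A :: "complex ^ 'n \<Rightarrow> complex ^ 'm"
  assumes A: "clinear A"
  shows "hadjoint Cn Cn A y = (\<chi> i. \<Sum>k\<in>UNIV. cnj (A (stdb i) $ k) * y $ k)"
proof -
  define x where "x = (\<chi> i. \<Sum>k\<in>UNIV. cnj (A (stdb i) $ k) * y $ k)"
  have adj: "(\<Sum>i\<in>UNIV. cnj (x $ i) * z $ i) = (\<Sum>k\<in>UNIV. cnj (y $ k) * A z $ k)" for z
  proof -
    have "(\<Sum>i\<in>UNIV. cnj (x $ i) * z $ i)
        = (\<Sum>i\<in>UNIV. \<Sum>k\<in>UNIV. A (stdb i) $ k * cnj (y $ k) * z $ i)"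
      by (simp add: x_def sum_distrib_right)
    also have "\<dots> = (\<Sum>k\<in>UNIV. \<Sum>i\<in>UNIV. A (stdb i) $ k * cnj (y $ k) * z $ i)"
      by (rule sum.swap)
    also have "\<dots> = (\<Sum>k\<in>UNIV. cnj (y $ k) * A z $ k)"
      by (subst (2) clinear_vec[OF A]) (simp add: sum_distrib_left mult_ac)
    finally show ?thesis .
  qed
  show ?thesis
    unfolding hadjoint_def Cn_def x_def[symmetric]
  proof (rule the_equality)
    fix x' assume "x' \<in> hcarrier \<lparr>hcarrier = UNIV, hinner = (\<lambda>x y. \<Sum>i\<in>UNIV. cnj (x $ i) * y $ i)\<rparr> \<and>
      (\<forall>z\<in>hcarrier \<lparr>hcarrier = UNIV, hinner = (\<lambda>x y. \<Sum>i\<in>UNIV. cnj (x $ i) * y $ i)\<rparr>.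
        hinner \<lparr>hcarrier = UNIV, hinner = (\<lambda>x y. \<Sum>i\<in>UNIV. cnj (x $ i) * y $ i)\<rparr> x' z
        = hinner \<lparr>hcarrier = UNIV, hinner = (\<lambda>x y. \<Sum>i\<in>UNIV. cnj (x $ i) * y $ i)\<rparr> y (A z))"
    then have "(\<Sum>i\<in>UNIV. cnj (x' $ i) * stdb j $ i) = (\<Sum>i\<in>UNIV. cnj (x $ i) * stdb j $ i)" for j
      by (simp add: adj)
    then have "cnj (x' $ j) = cnj (x $ j)" for j
      using sum_stdb[of j "\<lambda>i. cnj (x' $ i)"] sum_stdb[of j "\<lambda>i. cnj (x $ i)"]
      by (simp add: mult.commute)
    then show "x' = x" by (simp add: vec_eq_iff)
  qed (simp add: adj)
qed

text \<open>For an antilinear map the matrix of the adjoint is the plain transpose; the conjugation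
  falls on the argument.\<close>

lemma antilinear_adjoint_Cn:
  fixes A :: "complex ^ 'n \<Rightarrow> complex ^ 'm"
  assumes A: "antilinear A"
  shows "antilinear_adjoint Cn Cn A y = (\<chi> i. \<Sum>k\<in>UNIV. A (stdb i) $ k * cnj (y $ k))"
proof -
  define x where "x = (\<chi> i. \<Sum>k\<in>UNIV. A (stdb i) $ k * cnj (y $ k))"
  have adj: "(\<Sum>k\<in>UNIV. cnj (A z $ k) * y $ k) = (\<Sum>i\<in>UNIV. cnj (x $ i) * z $ i)" for z
  proof -
    have "(\<Sum>i\<in>UNIV. cnj (x $ i) * z $ i)
        = (\<Sum>i\<in>UNIV. \<Sum>k\<in>UNIV. cnj (A (stdb i) $ k) * y $ k * z $ i)"
      by (simp add: x_def sum_distrib_right)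
    also have "\<dots> = (\<Sum>k\<in>UNIV. \<Sum>i\<in>UNIV. cnj (A (stdb i) $ k) * y $ k * z $ i)"
      by (rule sum.swap)
    also have "\<dots> = (\<Sum>k\<in>UNIV. cnj (A z $ k) * y $ k)"
      by (subst (2) antilinear_vec[OF A]) (simp add: sum_distrib_left sum_distrib_right mult_ac)
    finally show ?thesis ..
  qed
  show ?thesis
    unfolding antilinear_adjoint_def Cn_def x_def[symmetric]
  proof (rule the_equality)
    fix x' assume "x' \<in> hcarrier \<lparr>hcarrier = UNIV, hinner = (\<lambda>x y. \<Sum>i\<in>UNIV. cnj (x $ i) * y $ i)\<rparr> \<and>
      (\<forall>z\<in>hcarrier \<lparr>hcarrier = UNIV, hinner = (\<lambda>x y. \<Sum>i\<in>UNIV. cnj (x $ i) * y $ i)\<rparr>.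
        hinner \<lparr>hcarrier = UNIV, hinner = (\<lambda>x y. \<Sum>i\<in>UNIV. cnj (x $ i) * y $ i)\<rparr> (A z) y
        = hinner \<lparr>hcarrier = UNIV, hinner = (\<lambda>x y. \<Sum>i\<in>UNIV. cnj (x $ i) * y $ i)\<rparr> x' z)"
    then have "(\<Sum>i\<in>UNIV. cnj (x' $ i) * stdb j $ i) = (\<Sum>i\<in>UNIV. cnj (x $ i) * stdb j $ i)" for j
      by (simp flip: adj)
    then have "cnj (x' $ j) = cnj (x $ j)" for j
      using sum_stdb[of j "\<lambda>i. cnj (x' $ i)"] sum_stdb[of j "\<lambda>i. cnj (x $ i)"]
      by (simp add: mult.commute)
    then show "x' = x" by (simp add: vec_eq_iff)
  qed (simp add: adj)
qed

section \<open>Inverses of antilinear maps and the conjugate equations in coordinates\<close>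

lemma antilinear_inv:
  assumes A: "antilinear A" "bij A"
  shows "antilinear (inv A)"
proof -
  have AI: "A (inv A x) = x" for x using A(2) by (simp add: bij_is_surj surj_f_inv_f)
  have IA: "inv A (A x) = x" for x using A(2) by (simp add: bij_is_inj)
  have "inv A (x + y) = inv A x + inv A y" for x y
    using IA[of "inv A x + inv A y"] by (simp add: antilinear_add[OF A(1)] AI)
  moreover have "inv A (c *\<^sub>C x) = cnj c *\<^sub>C inv A x" for c x
    using IA[of "cnj c *\<^sub>C inv A x"] by (simp add: antilinear_scale[OF A(1)] AI)
  ultimately show ?thesis by (simp add: antilinear_def)
qed

lemma antilinear_adjoint_Cn_inverse:
  fixes A :: "complex ^ 'n \<Rightarrow> complex ^ 'm" and B :: "complex ^ 'm \<Rightarrow> complex ^ 'n"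
  assumes A: "antilinear A" and B: "antilinear B" and BA: "\<And>x. B (A x) = x"
  shows "antilinear_adjoint Cn Cn A (antilinear_adjoint Cn Cn B x) = x"
proof -
  have "(\<Sum>k\<in>UNIV. A (stdb i) $ k * cnj (\<Sum>l\<in>UNIV. B (stdb k) $ l * cnj (x $ l))) = x $ i" for i
  proof -
    have "(\<Sum>k\<in>UNIV. A (stdb i) $ k * cnj (\<Sum>l\<in>UNIV. B (stdb k) $ l * cnj (x $ l)))
        = (\<Sum>k\<in>UNIV. \<Sum>l\<in>UNIV. A (stdb i) $ k * cnj (B (stdb k) $ l) * x $ l)"
      by (simp add: sum_distrib_left mult.assoc)
    also have "\<dots> = (\<Sum>l\<in>UNIV. \<Sum>k\<in>UNIV. A (stdb i) $ k * cnj (B (stdb k) $ l) * x $ l)"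
      by (rule sum.swap)
    also have "\<dots> = (\<Sum>l\<in>UNIV. cnj (B (A (stdb i)) $ l) * x $ l)"
      by (subst (2) antilinear_vec[OF B]) (simp add: sum_distrib_right)
    also have "\<dots> = (\<Sum>l\<in>UNIV. stdb i $ l *\<^sub>C x $ l)"
      by (intro sum.cong refl) (simp add: BA axis_def)
    finally show ?thesis unfolding sum_stdb .
  qed
  then show ?thesis by (simp add: antilinear_adjoint_Cn A B vec_eq_iff)
qed

text \<open>Entry \<open>k\<close> of the zigzag equation at \<open>stdb l\<close>. Units and
  reassociation only produce Kronecker deltas; what remains says that the coefficients of
  \<open>R\<close> and the conjugated ones of \<open>R'\<close> form inverse matrices.\<close>

lemma zigzag_coordinates:
  assumes R': "clinear R'" and zz: "zigzag R R'"
  shows "(\<Sum>i\<in>UNIV. R (stdb 1) $ (i, k) * cnj (R' (stdb 1) $ (l, i))) = (if l = k then 1 else 0)"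
proof -
  define x where "x = assoc_inv (map_tens id R (runit_inv (stdb l)))"
  have inner: "map_tens id R (runit_inv (stdb l)) $ (a, b) = stdb l $ a * R (stdb 1) $ b" for a b
  proof -
    obtain i k where b: "b = (i, k)" by (cases b)
    have "map_tens id R (runit_inv (stdb l)) $ (a, b)
        = (\<Sum>c\<in>UNIV. stdb l $ c *\<^sub>C (stdb c $ a * R (stdb 1) $ b))"
      by (simp add: map_tens_def runit_inv_def sum_UNIV_prod sum_1 b axis_def)
    then show ?thesis unfolding sum_stdb .
  qed
  have x: "x $ ((a, b), c) = stdb l $ a * R (stdb 1) $ (b, c)" for a b c
    by (simp add: x_def assoc_inv_def inner)
  have "lunit (map_tens (hadjoint Cn Cn R') id x) $ k
      = (\<Sum>a\<in>UNIV. \<Sum>b\<in>UNIV. \<Sum>c\<in>UNIV.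
          x $ ((a, b), c) * ((hadjoint Cn Cn R' (stdb (a, b)) $ 1) * stdb c $ k))"
    by (simp add: lunit_def map_tens_def sum_UNIV_prod)
  also have "\<dots> = (\<Sum>a\<in>UNIV. \<Sum>b\<in>UNIV. \<Sum>c\<in>UNIV.
      x $ ((a, b), c) * (cnj (R' (stdb 1) $ (a, b)) * stdb c $ k))"
  proof -
    have "hadjoint Cn Cn R' (stdb p) $ 1 = cnj (R' (stdb 1) $ p)" for p
      using sum_stdb[of p "\<lambda>q. cnj (R' (stdb 1) $ q)"] by (simp add: hadjoint_Cn[OF R'] mult.commute)
    then show ?thesis by simp
  qed
  also have "\<dots> = (\<Sum>a\<in>UNIV. \<Sum>b\<in>UNIV. \<Sum>c\<in>UNIV.
      stdb k $ c *\<^sub>C (stdb l $ a *\<^sub>C (R (stdb 1) $ (b, c) * cnj (R' (stdb 1) $ (a, b)))))"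
    by (intro sum.cong refl) (simp add: x axis_def)
  also have "\<dots> = (\<Sum>a\<in>UNIV. stdb l $ a *\<^sub>C (\<Sum>b\<in>UNIV. R (stdb 1) $ (b, k) * cnj (R' (stdb 1) $ (a, b))))"
    unfolding sum_stdb complex_vector.scale_sum_right ..
  also have "\<dots> = (\<Sum>b\<in>UNIV. R (stdb 1) $ (b, k) * cnj (R' (stdb 1) $ (l, b)))"
    by (rule sum_stdb)
  finally have "lunit (map_tens (hadjoint Cn Cn R') id x) $ k = \<dots>" .
  moreover have "lunit (map_tens (hadjoint Cn Cn R') id x) = stdb l"
    using zz by (simp add: zigzag_def x_def)
  ultimately show ?thesis by (simp add: axis_def eq_commute)
qed

text \<open>The antilinear map \<open>kk\<close> with the coefficients of \<open>R'\<close> is a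
  left inverse of \<open>j\<close> by the zigzag equation, hence equal to
  \<open>inv j\<close>.\<close>

lemma conjugate_of_inverse:
  fixes R :: "complex ^ 1 \<Rightarrow> complex ^ ('m::finite \<times> 'n::finite)"
  assumes j: "antilinear j" "bij j" and R: "R (stdb 1) = (\<Sum>i\<in>UNIV. vtens (j (stdb i)) (stdb i))"
    and R': "clinear R'" and zz: "zigzag R R'"
  shows "R' (stdb 1) = (\<Sum>k\<in>UNIV. vtens (inv j (stdb k)) (stdb k))"
proof -
  have Rc: "R (stdb 1) $ (i, k) = j (stdb k) $ i" for i k
    by (simp add: R)
  define kk where "kk = (\<lambda>y :: complex ^ 'm. (\<chi> l. \<Sum>i\<in>UNIV. cnj (y $ i) * R' (stdb 1) $ (l, i)) :: complex ^ 'n)"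
  have "kk (j x) = x" for x
  proof -
    have "kk (j x) $ l = x $ l" for l
    proof -
      have "kk (j x) $ l = (\<Sum>i\<in>UNIV. \<Sum>p\<in>UNIV. x $ p * (cnj (j (stdb p) $ i) * R' (stdb 1) $ (l, i)))"
        unfolding kk_def by (subst antilinear_vec[OF j(1)]) (simp add: sum_distrib_right mult.assoc)
      also have "\<dots> = (\<Sum>p\<in>UNIV. x $ p * cnj (\<Sum>i\<in>UNIV. R (stdb 1) $ (i, p) * cnj (R' (stdb 1) $ (l, i))))"
        by (subst sum.swap) (simp add: sum_distrib_left Rc)
      also have "\<dots> = x $ l"
        unfolding zigzag_coordinates[OF R' zz] by (simp add: if_distrib cong: if_cong)
      finally show ?thesis .
    qed
    then show ?thesis by (simp add: vec_eq_iff)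
  qed
  then have inv: "inv j y = kk y" for y
    using j(2) by (metis bij_inv_eq_iff)
  have "inv j (stdb k) $ l = R' (stdb 1) $ (l, k)" for k l
  proof -
    have "kk (stdb k) $ l = (\<Sum>i\<in>UNIV. stdb k $ i *\<^sub>C R' (stdb 1) $ (l, i))"
      unfolding kk_def vec_lambda_beta by (intro sum.cong refl) (simp add: axis_def)
    then show ?thesis unfolding sum_stdb inv .
  qed
  then show ?thesis by (simp add: vec_eq_iff split_paired_all)
qed

section \<open>Unitary matrices over a C*-algebra\<close>

text \<open>Of the two relations, the first makes the sum defining the inner product of
  \<open>Lbar\<close> a fixed point of the action; the second allows coefficients to be moved across
  the invariance of \<open>R\<close>.\<close>

definition unitary_matrix :: "('a::cstar_algebra) ^ 'n ^ 'n \<Rightarrow> bool"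
  where "unitary_matrix u \<longleftrightarrow>
    (\<forall>i k. (\<Sum>j\<in>UNIV. u $ i $ j * (u $ k $ j)\<^sup>\<star>) = (if i = k then 1 else 0)) \<and>
    (\<forall>i k. (\<Sum>j\<in>UNIV. (u $ j $ i)\<^sup>\<star> * u $ j $ k) = (if i = k then 1 else 0))"

lemma unitary_matrix_right:
    "unitary_matrix u \<Longrightarrow> (\<Sum>j\<in>UNIV. u $ i $ j * (u $ k $ j)\<^sup>\<star>) = (if i = k then 1 else 0)"
  and unitary_matrix_left:
    "unitary_matrix u \<Longrightarrow> (\<Sum>j\<in>UNIV. (u $ j $ i)\<^sup>\<star> * u $ j $ k) = (if i = k then 1 else 0)"
  by (simp_all add: unitary_matrix_def)

lemma unitary_rep_unitary_matrix: "unitary_rep t D u \<Longrightarrow> unitary_matrix u"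
  by (auto simp: unitary_rep_def unitary_matrix_def matrix_matrix_mult_def mat_def vec_eq_iff)

lemma rep_tens_nth [simp]: "rep_tens u v $ (i, p) $ (j, q) = u $ i $ j * v $ p $ q"
  by (simp add: rep_tens_def)

text \<open>Coefficients of \<open>u\<close> and \<open>v\<close> need not commute, so the adjacent
  pair must collapse first: that of \<open>v\<close> in the first relation, that of \<open>u\<close>
  in the second.\<close>

lemma unitary_matrix_rep_tens:
  fixes u :: "('a::cstar_algebra) ^ 'n ^ 'n" and v :: "'a ^ 'm ^ 'm"
  assumes u: "unitary_matrix u" and v: "unitary_matrix v"
  shows "unitary_matrix (rep_tens u v)"
proof -
  have "(\<Sum>j\<in>UNIV. \<Sum>q\<in>UNIV. u $ i $ j * v $ p $ q * (u $ k $ j * v $ r $ q)\<^sup>\<star>)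
      = (if (i, p) = (k, r) then 1 else 0)" for i k p r
  proof -
    have "(\<Sum>j\<in>UNIV. \<Sum>q\<in>UNIV. u $ i $ j * v $ p $ q * (u $ k $ j * v $ r $ q)\<^sup>\<star>)
        = (\<Sum>j\<in>UNIV. u $ i $ j * (\<Sum>q\<in>UNIV. v $ p $ q * (v $ r $ q)\<^sup>\<star>) * (u $ k $ j)\<^sup>\<star>)"
      by (simp add: star_mult sum_distrib_left sum_distrib_right mult.assoc)
    then show ?thesis using unitary_matrix_right[OF u] unitary_matrix_right[OF v] by simp
  qed
  moreover have "(\<Sum>j\<in>UNIV. \<Sum>q\<in>UNIV. (u $ j $ i * v $ q $ p)\<^sup>\<star> * (u $ j $ k * v $ q $ r))
      = (if (i, p) = (k, r) then 1 else 0)" for i k p r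
  proof -
    have "(\<Sum>j\<in>UNIV. \<Sum>q\<in>UNIV. (u $ j $ i * v $ q $ p)\<^sup>\<star> * (u $ j $ k * v $ q $ r))
        = (\<Sum>q\<in>UNIV. \<Sum>j\<in>UNIV. (v $ q $ p)\<^sup>\<star> * ((u $ j $ i)\<^sup>\<star> * u $ j $ k) * v $ q $ r)"
      by (subst sum.swap) (simp add: star_mult mult.assoc)
    also have "\<dots> = (\<Sum>q\<in>UNIV. (v $ q $ p)\<^sup>\<star> * (\<Sum>j\<in>UNIV. (u $ j $ i)\<^sup>\<star> * u $ j $ k) * v $ q $ r)"
      by (simp add: sum_distrib_left sum_distrib_right)
    finally show ?thesis using unitary_matrix_left[OF u] unitary_matrix_left[OF v] by simp
  qed
  ultimately show ?thesis
    unfolding unitary_matrix_def by (simp add: sum_UNIV_prod split_paired_all)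
qed

lemma arrow_trivial:
  assumes R: "R \<in> arrows trivial_rep w"
  shows "clinear R"
    and "(\<Sum>q\<in>UNIV. R (stdb 1) $ q *\<^sub>C w $ p $ q) = R (stdb 1) $ p *\<^sub>C 1"
proof -
  show "clinear R" using R by (simp add: arrows_def)
  have "amplify R (rep_map trivial_rep (stdb 1)) $ p = rep_map w (R (stdb 1)) $ p"
    using R by (simp add: arrows_def)
  then show "(\<Sum>q\<in>UNIV. R (stdb 1) $ q *\<^sub>C w $ p $ q) = R (stdb 1) $ p *\<^sub>C 1"
    by (simp add: amplify_def rep_map_def sum_1 mat_def scaleC_one)
qed

text \<open>One direction of the duality. It holds for \<open>j\<close> with \<open>R\<close> and
  for \<open>inv j\<close> with \<open>Rbar\<close>, the two representations being
  exchanged.\<close>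

definition conjugation ::
    "('a::cstar_algebra) ^ 'n ^ 'n \<Rightarrow> 'a ^ 'm ^ 'm \<Rightarrow> (complex ^ 'n \<Rightarrow> complex ^ 'm)
      \<Rightarrow> (complex ^ 1 \<Rightarrow> complex ^ ('m \<times> 'n)) \<Rightarrow> bool"
  where "conjugation u v j R \<longleftrightarrow> unitary_matrix u \<and> unitary_matrix v \<and> antilinear j \<and>
    R \<in> arrows trivial_rep (rep_tens v u) \<and>
    R (stdb 1) = (\<Sum>i\<in>UNIV. vtens (j (stdb i)) (stdb i))"

lemma conjugation_coordinates:
  "conjugation u v j R \<Longrightarrow> R (stdb 1) $ (k, i) = j (stdb i) $ k"
  by (simp add: conjugation_def)

text \<open>The vector \<open>R (stdb 1)\<close> is fixed by \<open>rep_tens v u\<close>.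
  Multiplying this identity on the left by starred coefficients of \<open>v\<close> and summing
  cancels \<open>v\<close> by unitarity.\<close>

lemma conjugation_intertwines:
  assumes C: "conjugation u v j R"
  shows "(\<Sum>p\<in>UNIV. (j (stdb p) $ l) *\<^sub>C u $ i $ p) = (\<Sum>k\<in>UNIV. (j (stdb i) $ k) *\<^sub>C (v $ k $ l)\<^sup>\<star>)"
proof -
  have v: "unitary_matrix v" and R: "R \<in> arrows trivial_rep (rep_tens v u)"
    using C by (simp_all add: conjugation_def)
  have inv: "(\<Sum>b\<in>UNIV. \<Sum>d\<in>UNIV. (j (stdb d) $ b) *\<^sub>C (v $ a $ b * u $ c $ d)) = (j (stdb c) $ a) *\<^sub>C 1" for a c
    using arrow_trivial(2)[OF R, of "(a, c)"] by (simp add: sum_UNIV_prod conjugation_coordinates[OF C])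
  have "(\<Sum>k\<in>UNIV. (j (stdb i) $ k) *\<^sub>C (v $ k $ l)\<^sup>\<star>)
      = (\<Sum>k\<in>UNIV. (v $ k $ l)\<^sup>\<star> * ((j (stdb i) $ k) *\<^sub>C 1))"
    by (simp add: mult_scaleC_right)
  also have "\<dots> = (\<Sum>k\<in>UNIV. \<Sum>b\<in>UNIV. \<Sum>d\<in>UNIV. (j (stdb d) $ b) *\<^sub>C ((v $ k $ l)\<^sup>\<star> * v $ k $ b * u $ i $ d))"
    by (simp add: mult_scaleC_right sum_distrib_left mult.assoc flip: inv)
  also have "\<dots> = (\<Sum>b\<in>UNIV. \<Sum>d\<in>UNIV. \<Sum>k\<in>UNIV. (j (stdb d) $ b) *\<^sub>C ((v $ k $ l)\<^sup>\<star> * v $ k $ b * u $ i $ d))"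
    by (subst sum.swap, intro sum.cong refl, rule sum.swap)
  also have "\<dots> = (\<Sum>b\<in>UNIV. \<Sum>d\<in>UNIV. (j (stdb d) $ b) *\<^sub>C ((\<Sum>k\<in>UNIV. (v $ k $ l)\<^sup>\<star> * v $ k $ b) * u $ i $ d))"
    by (simp only: sum_distrib_right complex_vector.scale_sum_right)
  also have "\<dots> = (\<Sum>b\<in>UNIV. stdb l $ b *\<^sub>C (\<Sum>d\<in>UNIV. (j (stdb d) $ b) *\<^sub>C u $ i $ d))"
    unfolding unitary_matrix_left[OF v] by (intro sum.cong refl) (simp add: axis_def scaleC_one)
  also have "\<dots> = (\<Sum>d\<in>UNIV. (j (stdb d) $ l) *\<^sub>C u $ i $ d)" by (rule sum_stdb)
  finally show ?thesis ..
qed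

section \<open>Spectral spaces\<close>

lemma unbar_bar [simp]: "unbar (bar x) = x"
  by (simp add: bar_inverse)

lemma bar_unbar [simp]: "bar (unbar x) = x"
  by (rule unbar_inverse)

lemma unbar_0: "unbar 0 = 0"
  and unbar_add: "unbar (x + y) = unbar x + unbar y"
  and unbar_scale: "unbar (c *\<^sub>C x) = cnj c *\<^sub>C unbar x"
  by (simp_all add: zero_cconj_def plus_cconj_def scaleC_cconj_def)

lemma bar_eq_iff: "bar x = y \<longleftrightarrow> x = unbar y"
  by (metis unbar_bar bar_unbar)

lemma sum_fun_apply: "(\<Sum>i\<in>I. f i) x = (\<Sum>i\<in>I. f i x)"
  by (induction I rule: infinite_finite_induct) simp_all

lemma clinear_vec_eqI:
  assumes "clinear S" "clinear T" "\<And>i. S (stdb i) = T (stdb i)"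
  shows "S = T"
proof
  fix x show "S x = T x"
    unfolding clinear_vec[OF assms(1), of x] clinear_vec[OF assms(2), of x] by (simp add: assms(3))
qed

lemma clinear_vec_sum: "clinear (\<lambda>x. \<Sum>i\<in>UNIV. x $ i *\<^sub>C f i)"
  by (simp add: clinear_iff scaleC_add_left sum.distrib complex_vector.scale_sum_right flip: scaleC_scaleC)

lemma spec_mult_stdb: "spec_mult S T (stdb (i, k)) = S (stdb i) * T (stdb k)"
  using sum_stdb[of "(i, k)" "\<lambda>p. S (stdb (fst p)) * T (stdb (snd p))"]
  by (simp add: spec_mult_def case_prod_beta')

lemma clinear_spec_mult: "clinear (spec_mult S T)"
  using clinear_vec_sum[of "\<lambda>p. S (stdb (fst p)) * T (stdb (snd p))"]
  by (simp add: spec_mult_def[abs_def] case_prod_beta')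

text \<open>The adjoint of \<open>j\<close> and the star are both antilinear, so the vector enters
  linearly.\<close>

lemma J_bar_apply:
  assumes j: "antilinear j" and T: "clinear (unbar T)"
  shows "unbar (J_bar j T) \<psi>
    = (\<Sum>l\<in>UNIV. \<psi> $ l *\<^sub>C (\<Sum>p\<in>UNIV. cnj (j (stdb p) $ l) *\<^sub>C (unbar T (stdb p))\<^sup>\<star>))"
proof -
  have "unbar (J_bar j T) \<psi>
      = (\<Sum>p\<in>UNIV. \<Sum>l\<in>UNIV. (cnj (j (stdb p) $ l) * \<psi> $ l) *\<^sub>C (unbar T (stdb p))\<^sup>\<star>)"
    unfolding J_bar_def unbar_bar
    by (subst clinear_vec[OF T])
      (simp add: antilinear_adjoint_Cn[OF j] star_sum star_scaleC complex_vector.scale_sum_left)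
  also have "\<dots> = (\<Sum>l\<in>UNIV. \<Sum>p\<in>UNIV. (cnj (j (stdb p) $ l) * \<psi> $ l) *\<^sub>C (unbar T (stdb p))\<^sup>\<star>)"
    by (rule sum.swap)
  finally show ?thesis
    by (simp add: complex_vector.scale_sum_right scaleC_scaleC mult.commute)
qed

lemma J_bar_stdb:
  assumes "antilinear j" "clinear (unbar T)"
  shows "unbar (J_bar j T) (stdb l) = (\<Sum>p\<in>UNIV. cnj (j (stdb p) $ l) *\<^sub>C (unbar T (stdb p))\<^sup>\<star>)"
  unfolding J_bar_apply[OF assms] by (rule sum_stdb)

lemma clinear_J_bar:
  assumes "antilinear j" "clinear (unbar T)"
  shows "clinear (unbar (J_bar j T))"
proof -
  have "unbar (J_bar j T)
      = (\<lambda>\<psi>. \<Sum>l\<in>UNIV. \<psi> $ l *\<^sub>C (\<Sum>p\<in>UNIV. cnj (j (stdb p) $ l) *\<^sub>C (unbar T (stdb p))\<^sup>\<star>))"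
    by (rule ext) (rule J_bar_apply[OF assms])
  then show ?thesis using clinear_vec_sum by simp
qed

lemma antilinear_J_bar: "antilinear (J_bar j)"
  by (simp add: antilinear_def J_bar_def unbar_add unbar_scale plus_cconj_def scaleC_cconj_def
      star_add star_scaleC scaleC_fun_def plus_fun_def bar_eq_iff)

lemma J_bar_inverse:
  assumes "antilinear j" "antilinear i" "\<And>x. i (j x) = x"
  shows "J_bar i (J_bar j T) = T"
  by (simp add: J_bar_def antilinear_adjoint_Cn_inverse[OF assms] star_star)

section \<open>Inner products on spectral spaces, the antilinear map between them, and the
  multiplication maps\<close>

context nondegenerate_ergodic_action
begin

lemma tB_linear_left: "clinear (\<lambda>b. tB b a)" and tB_linear_right: "clinear (tB b)"
  and tB_mult: "tB b a * tB b' a' = tB (b * b') (a * a')"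
  and tB_star: "(tB b a)\<^sup>\<star> = tB (b\<^sup>\<star>) (a\<^sup>\<star>)" and tB_one: "tB 1 1 = 1"
  by (insert tB, simp_all add: min_tensor_def)

lemma \<eta>_linear: "clinear \<eta>" and \<eta>_mult: "\<eta> (x * y) = \<eta> x * \<eta> y"
  and \<eta>_star: "\<eta> (x\<^sup>\<star>) = (\<eta> x)\<^sup>\<star>" and \<eta>_one: "\<eta> 1 = 1"
  by (insert action_hom, simp_all add: unital_star_hom_def)

lemmas tB_sum_left = clinear_sum[OF tB_linear_left]
  and tB_sum_right = clinear_sum[OF tB_linear_right]
  and tB_scale_left = clinear_scale[OF tB_linear_left]
  and tB_scale_right = clinear_scale[OF tB_linear_right]
  and tB_add_left = clinear_add[OF tB_linear_left]
  and tB_0_right = clinear_0[OF tB_linear_right]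
  and \<eta>_sum = clinear_sum[OF \<eta>_linear]
  and \<eta>_scale = clinear_scale[OF \<eta>_linear]
  and \<eta>_add = clinear_add[OF \<eta>_linear]

abbreviation L :: "'a ^ 'n ^ 'n \<Rightarrow> (complex ^ 'n \<Rightarrow> 'b) cconj hspace"
  where "L \<equiv> Lbar tB \<eta>"

lemma L_iff: "T \<in> hcarrier (L u) \<longleftrightarrow> clinear (unbar T) \<and>
    (\<forall>l. \<eta> (unbar T (stdb l)) = (\<Sum>i\<in>UNIV. tB (unbar T (stdb i)) (u $ i $ l)))"
proof -
  have stdb: "rep_map u (stdb l) $ i = u $ i $ l" for l i
    by (simp add: rep_map_def)
  have "\<eta> (unbar T \<psi>) = (\<Sum>i\<in>UNIV. tB (unbar T (stdb i)) (rep_map u \<psi> $ i))"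
    if T: "clinear (unbar T)"
      and eq: "\<And>l. \<eta> (unbar T (stdb l)) = (\<Sum>i\<in>UNIV. tB (unbar T (stdb i)) (u $ i $ l))" for \<psi>
  proof -
    have "\<eta> (unbar T \<psi>) = (\<Sum>l\<in>UNIV. \<Sum>i\<in>UNIV. \<psi> $ l *\<^sub>C tB (unbar T (stdb i)) (u $ i $ l))"
      by (subst clinear_vec[OF T]) (simp add: \<eta>_sum \<eta>_scale eq complex_vector.scale_sum_right)
    also have "\<dots> = (\<Sum>i\<in>UNIV. \<Sum>l\<in>UNIV. \<psi> $ l *\<^sub>C tB (unbar T (stdb i)) (u $ i $ l))"
      by (rule sum.swap)
    finally show ?thesis by (simp add: rep_map_def tB_sum_right tB_scale_right)
  qed
  moreover have "T \<in> hcarrier (L u) \<longleftrightarrow> clinear (unbar T) \<and>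
      (\<forall>\<psi>. \<eta> (unbar T \<psi>) = (\<Sum>i\<in>UNIV. tB (unbar T (stdb i)) (rep_map u \<psi> $ i)))"
    unfolding Lbar_def by (auto intro!: exI[of _ "unbar T"])
  ultimately show ?thesis by (metis (no_types, lifting) stdb sum.cong)
qed

lemma L_linear: "T \<in> hcarrier (L u) \<Longrightarrow> clinear (unbar T)"
  and L_coaction: "T \<in> hcarrier (L u) \<Longrightarrow>
    \<eta> (unbar T (stdb l)) = (\<Sum>i\<in>UNIV. tB (unbar T (stdb i)) (u $ i $ l))"
  by (simp_all add: L_iff)

lemma L_inner_eqI:
  assumes "c *\<^sub>C 1 = (\<Sum>i\<in>UNIV. unbar S (stdb i) * (unbar T (stdb i))\<^sup>\<star>)"
  shows "hinner (L u) S T = c"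
  unfolding Lbar_def hspace.select_convs assms[symmetric] by (simp add: scaleC_one_eq_iff)

text \<open>Applying the action to the sum, unitarity of \<open>u\<close> collapses the coefficients
  to 1; the sum is therefore a fixed point, and ergodicity makes it a scalar.\<close>

lemma L_inner:
  assumes u: "unitary_matrix u" and S: "S \<in> hcarrier (L u)" and T: "T \<in> hcarrier (L u)"
  shows "hinner (L u) S T *\<^sub>C 1 = (\<Sum>i\<in>UNIV. unbar S (stdb i) * (unbar T (stdb i))\<^sup>\<star>)"
proof -
  let ?s = "\<lambda>i. unbar S (stdb i)" and ?t = "\<lambda>i. unbar T (stdb i)"
  let ?x = "\<Sum>l\<in>UNIV. ?s l * (?t l)\<^sup>\<star>"
  have "\<eta> ?x = (\<Sum>l\<in>UNIV. \<Sum>i\<in>UNIV. \<Sum>k\<in>UNIV. tB (?s i * (?t k)\<^sup>\<star>) (u $ i $ l * (u $ k $ l)\<^sup>\<star>))"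
    by (simp add: \<eta>_sum \<eta>_mult \<eta>_star L_coaction[OF S] L_coaction[OF T] star_sum tB_star
        sum_product tB_mult)
  also have "\<dots> = (\<Sum>i\<in>UNIV. \<Sum>k\<in>UNIV. \<Sum>l\<in>UNIV. tB (?s i * (?t k)\<^sup>\<star>) (u $ i $ l * (u $ k $ l)\<^sup>\<star>))"
    by (subst sum.swap, rule sum.cong, rule refl, rule sum.swap)
  also have "\<dots> = (\<Sum>i\<in>UNIV. \<Sum>k\<in>UNIV. tB (?s i * (?t k)\<^sup>\<star>) (if i = k then 1 else 0))"
    by (simp only: unitary_matrix_right[OF u] flip: tB_sum_right)
  also have "\<dots> = (\<Sum>i\<in>UNIV. \<Sum>k\<in>UNIV. if i = k then tB (?s i * (?t k)\<^sup>\<star>) 1 else 0)"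
    by (intro sum.cong refl) (simp add: tB_0_right)
  also have "\<dots> = tB ?x 1" by (simp add: tB_sum_left)
  finally obtain c where "?x = c *\<^sub>C 1" using ergodic by blast
  then show ?thesis using L_inner_eqI[of c S T u] by simp
qed

text \<open>Linearity in the second variable results from two conjugations, that of the conjugate
  space and that of the star.\<close>

lemma L_inner_product_space:
  assumes u: "unitary_matrix u"
  shows "inner_product_space (L u)"
proof
  show "complex_vector.subspace (hcarrier (L u))"
    unfolding complex_vector.subspace_def
    by (auto simp: L_iff unbar_0 unbar_add unbar_scale zero_fun_def plus_fun_def scaleC_fun_def
        clinear_iff \<eta>_add \<eta>_scale tB_add_left tB_scale_left sum.distrib clinear_0[OF \<eta>_linear]
        clinear_0[OF tB_linear_left] scaleC_add_right scaleC_left_commute complex_vector.scale_sum_right)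
  fix x y z c
  assume x: "x \<in> hcarrier (L u)"
  show "0 \<le> Re (hinner (L u) x x)" by (rule sum_mult_star_scalar(1)[OF L_inner[OF u x x]])
  show "x = 0" if "hinner (L u) x x = 0"
  proof -
    have "unbar x (stdb i) = 0" for i by (rule sum_mult_star_scalar(2)[OF L_inner[OF u x x] that])
    then have "unbar x = unbar 0"
      by (intro clinear_vec_eqI L_linear[OF x]) (simp_all add: unbar_0 clinear_iff)
    then show ?thesis by (metis bar_unbar)
  qed
  assume y: "y \<in> hcarrier (L u)"
  note xy = L_inner[OF u x y]
  show "hinner (L u) x (c *\<^sub>C y) = c * hinner (L u) x y"
    by (rule L_inner_eqI)
      (simp add: unbar_scale scaleC_fun_def star_scaleC mult_scaleC_right
        flip: complex_vector.scale_sum_right scaleC_scaleC xy)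
  show "hinner (L u) x y = cnj (hinner (L u) y x)"
  proof (rule L_inner_eqI)
    have "(hinner (L u) y x *\<^sub>C 1)\<^sup>\<star> = (\<Sum>i\<in>UNIV. unbar x (stdb i) * (unbar y (stdb i))\<^sup>\<star>)"
      unfolding L_inner[OF u y x] star_sum star_mult star_star ..
    then show "cnj (hinner (L u) y x) *\<^sub>C 1 = (\<Sum>i\<in>UNIV. unbar x (stdb i) * (unbar y (stdb i))\<^sup>\<star>)"
      by (simp add: star_scaleC)
  qed
  assume z: "z \<in> hcarrier (L u)"
  show "hinner (L u) x (y + z) = hinner (L u) x y + hinner (L u) x z"
    by (rule L_inner_eqI)
      (simp add: unbar_add star_add distrib_left sum.distrib scaleC_add_left xy L_inner[OF u x z])
qed

text \<open>The action produces starred coefficients of \<open>u\<close> contracted with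
  \<open>j\<close>; the star of \<open>conjugation_intertwines\<close> turns them into coefficients
  of \<open>v\<close>.\<close>

lemma J_bar_carrier:
  assumes C: "conjugation u v j R" and T: "T \<in> hcarrier (L u)"
  shows "J_bar j T \<in> hcarrier (L v)"
proof -
  have j: "antilinear j" using C by (simp add: conjugation_def)
  let ?t = "\<lambda>i. (unbar T (stdb i))\<^sup>\<star>" and ?m = "\<lambda>p l. j (stdb p) $ l"
  have "\<eta> (unbar (J_bar j T) (stdb l)) = (\<Sum>k\<in>UNIV. tB (unbar (J_bar j T) (stdb k)) (v $ k $ l))" for l
  proof -
    have "\<eta> (unbar (J_bar j T) (stdb l))
        = (\<Sum>p\<in>UNIV. \<Sum>i\<in>UNIV. cnj (?m p l) *\<^sub>C tB (?t i) ((u $ i $ p)\<^sup>\<star>))"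
      by (simp add: J_bar_stdb[OF j L_linear[OF T]] \<eta>_sum \<eta>_scale \<eta>_star L_coaction[OF T] star_sum
          tB_star complex_vector.scale_sum_right)
    also have "\<dots> = (\<Sum>i\<in>UNIV. \<Sum>p\<in>UNIV. cnj (?m p l) *\<^sub>C tB (?t i) ((u $ i $ p)\<^sup>\<star>))"
      by (rule sum.swap)
    also have "\<dots> = (\<Sum>i\<in>UNIV. tB (?t i) ((\<Sum>p\<in>UNIV. ?m p l *\<^sub>C u $ i $ p)\<^sup>\<star>))"
      by (simp add: star_sum star_scaleC tB_sum_right tB_scale_right)
    also have "\<dots> = (\<Sum>i\<in>UNIV. \<Sum>k\<in>UNIV. cnj (?m i k) *\<^sub>C tB (?t i) (v $ k $ l))"
      by (simp add: conjugation_intertwines[OF C] star_sum star_scaleC star_star tB_sum_right tB_scale_right)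
    also have "\<dots> = (\<Sum>k\<in>UNIV. \<Sum>i\<in>UNIV. cnj (?m i k) *\<^sub>C tB (?t i) (v $ k $ l))"
      by (rule sum.swap)
    also have "\<dots> = (\<Sum>k\<in>UNIV. tB (unbar (J_bar j T) (stdb k)) (v $ k $ l))"
      by (simp add: J_bar_stdb[OF j L_linear[OF T]] tB_sum_left tB_scale_left)
    finally show ?thesis .
  qed
  then show ?thesis by (simp add: L_iff clinear_J_bar[OF j L_linear[OF T]])
qed

lemma spec_mult_carrier:
  assumes S: "S \<in> hcarrier (L v)" and T: "T \<in> hcarrier (L u)"
  shows "bar (spec_mult (unbar S) (unbar T)) \<in> hcarrier (L (rep_tens v u))"
  by (simp add: L_iff clinear_spec_mult spec_mult_stdb split_paired_all sum_UNIV_prod \<eta>_mult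
      L_coaction[OF S] L_coaction[OF T] sum_product tB_mult)

text \<open>The sum over the inner factors \<open>T\<close> and \<open>T'\<close> is a scalar, so it
  can be pulled out from between \<open>S\<close> and the star of \<open>S'\<close>.\<close>

lemma inner_spec_mult:
  assumes u: "unitary_matrix u" and v: "unitary_matrix v"
    and S: "S \<in> hcarrier (L v)" "S' \<in> hcarrier (L v)" and T: "T \<in> hcarrier (L u)" "T' \<in> hcarrier (L u)"
  shows "hinner (L (rep_tens v u)) (bar (spec_mult (unbar S) (unbar T)))
      (bar (spec_mult (unbar S') (unbar T'))) = hinner (L v) S S' * hinner (L u) T T'"
proof (rule L_inner_eqI)
  have "(\<Sum>k\<in>UNIV. \<Sum>i\<in>UNIV. unbar S (stdb k) * unbar T (stdb i) * (unbar S' (stdb k) * unbar T' (stdb i))\<^sup>\<star>)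
      = (\<Sum>k\<in>UNIV. unbar S (stdb k) * (\<Sum>i\<in>UNIV. unbar T (stdb i) * (unbar T' (stdb i))\<^sup>\<star>) * (unbar S' (stdb k))\<^sup>\<star>)"
    by (simp add: star_mult sum_distrib_left sum_distrib_right mult.assoc)
  also have "\<dots> = (hinner (L v) S S' * hinner (L u) T T') *\<^sub>C 1"
    by (simp add: mult_scaleC_left mult_scaleC_right scaleC_scaleC mult.commute
        flip: L_inner[OF u T] L_inner[OF v S] complex_vector.scale_sum_right)
  finally show "(hinner (L v) S S' * hinner (L u) T T') *\<^sub>C 1
    = (\<Sum>p\<in>UNIV. unbar (bar (spec_mult (unbar S) (unbar T))) (stdb p) *
      (unbar (bar (spec_mult (unbar S') (unbar T'))) (stdb p))\<^sup>\<star>)"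
    by (simp add: sum_UNIV_prod spec_mult_stdb)
qed

lemma Lbar_arrow_unit:
  assumes w: "unitary_matrix w" and R: "R \<in> arrows trivial_rep w"
  shows "unbar (Lbar_arrow R Lbar_unit) (stdb p) = cnj (R (stdb 1) $ p) *\<^sub>C (1::'b)"
    and "Lbar_arrow R Lbar_unit \<in> hcarrier (L w)"
proof -
  let ?y = "Lbar_arrow R (Lbar_unit :: (complex ^ 1 \<Rightarrow> 'b) cconj)" and ?r = "\<lambda>p. R (stdb 1) $ p"
  note Rlin = arrow_trivial(1)[OF R]
  have y: "unbar ?y x = (\<Sum>p\<in>UNIV. x $ p *\<^sub>C (cnj (?r p) *\<^sub>C 1))" for x
    by (simp add: Lbar_arrow_def Lbar_unit_def hadjoint_Cn[OF Rlin] complex_vector.scale_sum_left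
        scaleC_scaleC mult.commute)
  show ys: "unbar ?y (stdb p) = cnj (?r p) *\<^sub>C 1" for p unfolding y by (rule sum_stdb)
  have "unbar ?y = (\<lambda>x. \<Sum>p\<in>UNIV. x $ p *\<^sub>C (cnj (?r p) *\<^sub>C 1))" by (rule ext) (rule y)
  then have lin: "clinear (unbar ?y)" by (simp only: clinear_vec_sum)
  \<comment> \<open>By unitarity a vector fixed by \<open>w\<close> is fixed by its adjoint matrix
    too; the star of that statement is the coaction condition for scalar values.\<close>
  have fixed: "(\<Sum>p\<in>UNIV. cnj (?r p) *\<^sub>C w $ p $ q) = cnj (?r q) *\<^sub>C 1" for q
  proof -
    have "(\<Sum>p\<in>UNIV. ?r p *\<^sub>C (w $ p $ q)\<^sup>\<star>) = (\<Sum>p\<in>UNIV. (w $ p $ q)\<^sup>\<star> * (\<Sum>k\<in>UNIV. ?r k *\<^sub>C w $ p $ k))"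
      by (simp add: arrow_trivial(2)[OF R] mult_scaleC_right)
    also have "\<dots> = (\<Sum>p\<in>UNIV. \<Sum>k\<in>UNIV. ?r k *\<^sub>C ((w $ p $ q)\<^sup>\<star> * w $ p $ k))"
      by (simp add: sum_distrib_left mult_scaleC_right)
    also have "\<dots> = (\<Sum>k\<in>UNIV. \<Sum>p\<in>UNIV. ?r k *\<^sub>C ((w $ p $ q)\<^sup>\<star> * w $ p $ k))"
      by (rule sum.swap)
    also have "\<dots> = (\<Sum>k\<in>UNIV. if q = k then ?r k *\<^sub>C 1 else 0)"
      by (intro sum.cong refl)
        (simp add: unitary_matrix_left[OF w] flip: complex_vector.scale_sum_right)
    finally have "(\<Sum>p\<in>UNIV. ?r p *\<^sub>C (w $ p $ q)\<^sup>\<star>) = ?r q *\<^sub>C 1" by simp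
    then have "(\<Sum>p\<in>UNIV. ?r p *\<^sub>C (w $ p $ q)\<^sup>\<star>)\<^sup>\<star> = (?r q *\<^sub>C 1)\<^sup>\<star>" by simp
    then show ?thesis by (simp add: star_sum star_scaleC star_star)
  qed
  have "\<eta> (unbar ?y (stdb q)) = (\<Sum>p\<in>UNIV. tB (unbar ?y (stdb p)) (w $ p $ q))" for q
  proof -
    have "(\<Sum>p\<in>UNIV. tB (unbar ?y (stdb p)) (w $ p $ q)) = tB 1 (\<Sum>p\<in>UNIV. cnj (?r p) *\<^sub>C w $ p $ q)"
      by (simp add: ys tB_scale_left tB_scale_right tB_sum_right)
    then show ?thesis by (simp add: fixed ys tB_scale_right tB_one \<eta>_scale \<eta>_one)
  qed
  then show "?y \<in> hcarrier (L w)" using lin by (simp add: L_iff)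
qed

text \<open>The star reverses the product of \<open>S\<close> and \<open>T\<close>, which puts the
  conjugated coefficients of \<open>j\<close> next to the star of \<open>T\<close>; contracted, they
  are the values of \<open>J_bar j T\<close>.\<close>

lemma inner_unit_spec_mult:
  assumes C: "conjugation u v j R" and S: "S \<in> hcarrier (L v)" and T: "T \<in> hcarrier (L u)"
  shows "hinner (L (rep_tens v u)) (Lbar_arrow R Lbar_unit) (bar (spec_mult (unbar S) (unbar T)))
    = hinner (L v) (J_bar j T) S"
proof (rule L_inner_eqI)
  have uv: "unitary_matrix u" "unitary_matrix v" and j: "antilinear j"
    and R: "R \<in> arrows trivial_rep (rep_tens v u)"
    using C by (simp_all add: conjugation_def)
  have "(\<Sum>k\<in>UNIV. \<Sum>i\<in>UNIV. cnj (j (stdb i) $ k) *\<^sub>C ((unbar T (stdb i))\<^sup>\<star> * (unbar S (stdb k))\<^sup>\<star>))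
      = (\<Sum>k\<in>UNIV. unbar (J_bar j T) (stdb k) * (unbar S (stdb k))\<^sup>\<star>)"
    by (simp add: J_bar_stdb[OF j L_linear[OF T]] sum_distrib_right mult_scaleC_left)
  also have "\<dots> = hinner (L v) (J_bar j T) S *\<^sub>C 1"
    by (rule L_inner[OF uv(2) J_bar_carrier[OF C T] S, symmetric])
  finally show "hinner (L v) (J_bar j T) S *\<^sub>C 1
    = (\<Sum>p\<in>UNIV. unbar (Lbar_arrow R Lbar_unit) (stdb p) *
      (unbar (bar (spec_mult (unbar S) (unbar T))) (stdb p))\<^sup>\<star>)"
    by (simp add: sum_UNIV_prod spec_mult_stdb conjugation_coordinates[OF C] mult_scaleC_left star_mult
        Lbar_arrow_unit(1)[OF unitary_matrix_rep_tens[OF uv(2,1)] R])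
qed

text \<open>
  Bessel's inequality for the orthogonal family \<open>J T \<otimes> T\<close>, where \<open>T\<close> runs through \<open>E\<close>.
\<close>

lemma sum_inner_J_bar_le:
  fixes u :: "'a ^ 'n ^ 'n" and v :: "'a ^ 'm ^ 'm"
  assumes C: "conjugation u v j R" and E: "orthonormal (L u) E"
  shows "(\<Sum>T\<in>E. Re (hinner (L v) (J_bar j T) (J_bar j T)))
    \<le> Re (hinner (L (rep_tens v u)) (Lbar_arrow R Lbar_unit) (Lbar_arrow R Lbar_unit))"
proof -
  have u: "unitary_matrix u" and v: "unitary_matrix v"
    and R: "R \<in> arrows trivial_rep (rep_tens v u)"
    using C by (simp_all add: conjugation_def)
  have w: "unitary_matrix (rep_tens v u)" by (rule unitary_matrix_rep_tens[OF v u])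
  interpret V: inner_product_space "L v" by (rule L_inner_product_space[OF v])
  interpret W: inner_product_space "L (rep_tens v u)" by (rule L_inner_product_space[OF w])
  define y :: "(complex ^ ('m \<times> 'n) \<Rightarrow> 'b) cconj" where "y = Lbar_arrow R Lbar_unit"
  define s where "s T = bar (spec_mult (unbar (J_bar j T)) (unbar T))"
    for T :: "(complex ^ 'n \<Rightarrow> 'b) cconj"
  define n where "n T = hinner (L v) (J_bar j T) (J_bar j T)"
    for T :: "(complex ^ 'n \<Rightarrow> 'b) cconj"
  have car: "T \<in> hcarrier (L u)" if "T \<in> E" for T
    using E that by (auto simp: orthonormal_def)
  have fin: "finite E" using E by (simp add: orthonormal_def)
  have J: "J_bar j T \<in> hcarrier (L v)" if "T \<in> E" for T using J_bar_carrier[OF C car[OF that]] .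
  have s: "s T \<in> hcarrier (L (rep_tens v u))" if "T \<in> E" for T
    unfolding s_def by (rule spec_mult_carrier[OF J[OF that] car[OF that]])
  have y: "y \<in> hcarrier (L (rep_tens v u))" unfolding y_def by (rule Lbar_arrow_unit(2)[OF w R])
  have ys: "hinner (L (rep_tens v u)) y (s T) = n T" if "T \<in> E" for T
    unfolding y_def s_def n_def by (rule inner_unit_spec_mult[OF C J[OF that] car[OF that]])
  have n_real: "cnj (n T) = n T" if "T \<in> E" for T
    unfolding n_def using V.inner_commute J[OF that] by metis
  have sy: "hinner (L (rep_tens v u)) (s T) y = n T" if "T \<in> E" for T
    using W.inner_commute[OF s[OF that] y] ys[OF that] n_real[OF that] by simp
  \<comment> \<open>The vectors \<open>J_bar j T\<close> need not be mutually orthogonal; the second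
    factors alone make the products orthogonal.\<close>
  have ss: "hinner (L (rep_tens v u)) (s T) (s T') = (if T = T' then n T else 0)"
    if "T \<in> E" "T' \<in> E" for T T'
    using E that unfolding s_def
    by (simp add: inner_spec_mult[OF u v J J car car] orthonormal_def n_def)
  \<comment> \<open>As \<open>y\<close> and \<open>s T\<close> have the same inner product as
    \<open>s T\<close> with itself, the projection of \<open>y\<close> is the plain sum, without
    division by \<open>n T\<close>.\<close>
  define x where "x = (\<Sum>T\<in>E. s T)"
  have x: "x \<in> hcarrier (L (rep_tens v u))" unfolding x_def by (intro W.carrier_sum s)
  have "hinner (L (rep_tens v u)) x x = (\<Sum>T\<in>E. \<Sum>T'\<in>E. if T = T' then n T else 0)"
    unfolding x_def
    by (subst W.inner_sum_left, use s in \<open>auto intro!: W.carrier_sum\<close>)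
      (intro sum.cong refl, subst W.inner_sum_right, use s ss in auto)
  then have xx: "hinner (L (rep_tens v u)) x x = (\<Sum>T\<in>E. n T)" using fin by simp
  have yx: "hinner (L (rep_tens v u)) y x = (\<Sum>T\<in>E. n T)"
    unfolding x_def using y s by (simp add: W.inner_sum_right ys)
  have xy: "hinner (L (rep_tens v u)) x y = (\<Sum>T\<in>E. n T)"
    unfolding x_def using y s by (simp add: W.inner_sum_left sy)
  have "hinner (L (rep_tens v u)) (y - x) (y - x) = hinner (L (rep_tens v u)) y y - (\<Sum>T\<in>E. n T)"
    using x y by (simp add: W.inner_diff_left W.inner_diff_right W.carrier_diff xx yx xy)
  then show ?thesis
    using W.inner_nonneg[OF W.carrier_diff[OF y x]] by (simp add: n_def y_def)
qed

lemma L_finite_dimensional: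
  assumes C: "conjugation u v j R" and C': "conjugation v u i R'" and ij: "\<And>x. i (j x) = x"
  shows "\<exists>E. orthonormal_basis (L u) E"
proof -
  have u: "unitary_matrix u" and v: "unitary_matrix v" and j: "antilinear j" and i: "antilinear i"
    using C C' by (simp_all add: conjugation_def)
  interpret U: inner_product_space "L u" by (rule L_inner_product_space[OF u])
  interpret V: inner_product_space "L v" by (rule L_inner_product_space[OF v])
  define a where "a = Re (hinner (L (rep_tens v u)) (Lbar_arrow R Lbar_unit) (Lbar_arrow R Lbar_unit))"
  define b where "b = Re (hinner (L (rep_tens u v)) (Lbar_arrow R' Lbar_unit) (Lbar_arrow R' Lbar_unit))"
  \<comment> \<open>Bessel's inequality for the inverse map, applied to the single normalised vector
    \<open>d *\<^sub>C J_bar j T\<close>, whose image is \<open>d *\<^sub>C T\<close>.\<close>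
  have lower: "1 \<le> b * Re (hinner (L v) (J_bar j T) (J_bar j T))"
    if T: "T \<in> hcarrier (L u)" and TT: "hinner (L u) T T = 1" for T
  proof -
    have S: "J_bar j T \<in> hcarrier (L v)" by (rule J_bar_carrier[OF C T])
    have iS: "J_bar i (J_bar j T) = T" by (rule J_bar_inverse[OF j i ij])
    define r where "r = Re (hinner (L v) (J_bar j T) (J_bar j T))"
    have r: "hinner (L v) (J_bar j T) (J_bar j T) = complex_of_real r"
      unfolding r_def by (rule V.inner_self_real[OF S])
    have "r \<noteq> 0"
    proof
      assume "r = 0"
      then have "J_bar j T = 0" using V.inner_eq_0D[OF S] r by simp
      then have "T = J_bar i 0" using iS by simp
      then have "T = 0" using antilinear_scale[OF antilinear_J_bar, of i 0 0] by simp
      then show False using TT U.inner_0_right[OF T] by simp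
    qed
    then have "r > 0" using V.inner_nonneg[OF S] by (simp add: r_def)
    define d where "d = complex_of_real (inverse (sqrt r))"
    have dd: "d * d * complex_of_real r = 1"
    proof -
      have "inverse (sqrt r) * inverse (sqrt r) * r = 1" using \<open>r > 0\<close> by (simp add: field_simps)
      then show ?thesis unfolding d_def by (metis of_real_1 of_real_mult)
    qed
    have "orthonormal (L v) {d *\<^sub>C J_bar j T}"
      using S dd unfolding orthonormal_def
      by (simp add: V.carrier_scale V.inner_scale_left V.inner_scale_right r d_def mult.assoc)
    from sum_inner_J_bar_le[OF C' this]
    have "Re (hinner (L u) (d *\<^sub>C T) (d *\<^sub>C T)) \<le> b"
      by (simp add: antilinear_scale[OF antilinear_J_bar] iS b_def d_def)
    then have "Re (d * d) \<le> b"
      using T TT by (simp add: U.inner_scale_left U.inner_scale_right U.carrier_scale d_def)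
    then have "Re (d * d) * r \<le> b * r" using \<open>r > 0\<close> by simp
    moreover have "Re (d * d) * r = 1" using arg_cong[OF dd, of Re] by (simp add: d_def)
    ultimately show ?thesis by (simp add: r_def)
  qed
  \<comment> \<open>Summing the lower bound over \<open>E\<close> and using Bessel's inequality for
    \<open>J_bar j\<close> bounds the cardinality by the product of \<open>b\<close> and
    \<open>a\<close>.\<close>
  have "card E \<le> nat \<lceil>\<bar>b\<bar> * \<bar>a\<bar>\<rceil>" if E: "orthonormal (L u) E" for E
  proof -
    have "real (card E) = (\<Sum>T\<in>E. 1)" by simp
    also have "\<dots> \<le> (\<Sum>T\<in>E. b * Re (hinner (L v) (J_bar j T) (J_bar j T)))"
      using E by (intro sum_mono lower) (auto simp: orthonormal_def)
    also have "\<dots> = b * (\<Sum>T\<in>E. Re (hinner (L v) (J_bar j T) (J_bar j T)))" by (simp add: sum_distrib_left)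
    also have "\<dots> \<le> \<bar>b\<bar> * \<bar>a\<bar>"
    proof -
      have "0 \<le> (\<Sum>T\<in>E. Re (hinner (L v) (J_bar j T) (J_bar j T)))"
        using E by (intro sum_nonneg V.inner_nonneg J_bar_carrier[OF C]) (auto simp: orthonormal_def)
      moreover have "(\<Sum>T\<in>E. Re (hinner (L v) (J_bar j T) (J_bar j T))) \<le> \<bar>a\<bar>"
        using sum_inner_J_bar_le[OF C E] by (simp add: a_def)
      ultimately show ?thesis by (intro mult_mono) auto
    qed
    finally show ?thesis by linarith
  qed
  then show ?thesis by (rule U.ex_orthonormal_basis)
qed

text \<open>Paired with the tensor of \<open>S\<close> and \<open>T\<close>, the sum reassembles the
  expansion of \<open>T\<close> under the antilinear \<open>J_bar j\<close>. This gives the inner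
  product of \<open>J_bar j T\<close> with \<open>S\<close>, which
  \<open>inner_unit_spec_mult\<close> identifies with the pairing demanded of the adjoint. Both
  bases serve to evaluate \<open>tens_lift\<close>.\<close>

lemma R_hat_eq:
  fixes u :: "'a ^ 'n ^ 'n" and v :: "'a ^ 'm ^ 'm"
  assumes C: "conjugation u v j R"
    and E: "orthonormal_basis (L u) E" and F: "orthonormal_basis (L v) F"
  shows "R_hat tB \<eta> v u R = (\<Sum>T\<in>E. tens (L v) (L u) (J_bar j T) T)"
proof -
  have u: "unitary_matrix u" and v: "unitary_matrix v" and R: "R \<in> arrows trivial_rep (rep_tens v u)"
    using C by (simp_all add: conjugation_def)
  have w: "unitary_matrix (rep_tens v u)" by (rule unitary_matrix_rep_tens[OF v u])
  interpret U: inner_product_space "L u" by (rule L_inner_product_space[OF u])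
  interpret V: inner_product_space "L v" by (rule L_inner_product_space[OF v])
  interpret VU: inner_product_space_pair "L v" "L u" ..
  let ?x = "\<Sum>T\<in>E. tens (L v) (L u) (J_bar j T) T"
  note Ecar = U.onb_carrier[OF E]
  have x: "?x \<in> hcarrier (tens_space (L v) (L u))"
    by (intro VU.tens_sum_carrier J_bar_carrier[OF C] Ecar)
  have eq: "hinner (tens_space (L v) (L u)) ?x (tens (L v) (L u) S T) = hinner (L v) (J_bar j T) S"
    if S: "S \<in> hcarrier (L v)" and T: "T \<in> hcarrier (L u)" for S T
  proof -
    have "?x (S, T) = (\<Sum>e\<in>E. hinner (L v) S (J_bar j e) * hinner (L u) T e)"
      using S T by (simp add: sum_fun_apply tens_def)
    then have "hinner (tens_space (L v) (L u)) ?x (tens (L v) (L u) S T)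
        = (\<Sum>e\<in>E. cnj (hinner (L v) S (J_bar j e)) * cnj (hinner (L u) T e))"
      by (simp add: VU.inner_tens_tens[OF x S T])
    also have "\<dots> = (\<Sum>e\<in>E. hinner (L u) e T * hinner (L v) (J_bar j e) S)"
      by (intro sum.cong refl)
        (simp add: V.inner_commute[of _ S] U.inner_commute[of _ T] S T Ecar J_bar_carrier[OF C])
    also have "\<dots> = hinner (L v) (\<Sum>e\<in>E. cnj (hinner (L u) e T) *\<^sub>C J_bar j e) S"
      by (simp add: V.inner_sum_left V.carrier_scale V.inner_scale_left S J_bar_carrier[OF C] Ecar)
    also have "(\<Sum>e\<in>E. cnj (hinner (L u) e T) *\<^sub>C J_bar j e) = J_bar j (\<Sum>e\<in>E. hinner (L u) e T *\<^sub>C e)"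
      by (simp add: antilinear_sum[OF antilinear_J_bar] antilinear_scale[OF antilinear_J_bar])
    also have "\<dots> = J_bar j T" using U.onb_expansion[OF E T] by simp
    finally show ?thesis .
  qed
  have lin: "clinear (\<lambda>S. bar (spec_mult (unbar S) (unbar T)))" "clinear (\<lambda>T. bar (spec_mult (unbar S) (unbar T)))"
    for S :: "(complex ^ 'm \<Rightarrow> 'b) cconj" and T :: "(complex ^ 'n \<Rightarrow> 'b) cconj"
    by (auto simp: clinear_iff plus_cconj_def scaleC_cconj_def bar_eq_iff fun_eq_iff spec_mult_def
        scaleC_fun_def case_prod_beta' distrib_left distrib_right scaleC_add_right sum.distrib
        mult_scaleC_left mult_scaleC_right complex_vector.scale_sum_right scaleC_scaleC mult.commute)
  show ?thesis
    unfolding R_hat_def S_map_def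
    by (rule VU.hadjoint_tens_lift_eq[OF L_inner_product_space[OF w] F E])
      (use lin x eq spec_mult_carrier Lbar_arrow_unit(2)[OF w R] inner_unit_spec_mult[OF C] in auto)
qed

end

theorem theorem7p4:
  fixes tA :: "'a::cstar_algebra \<Rightarrow> 'a \<Rightarrow> 'aa::cstar_algebra"
    and tA_AA :: "'a \<Rightarrow> 'aa \<Rightarrow> 'aaa::cstar_algebra"
    and tAA_A :: "'aa \<Rightarrow> 'a \<Rightarrow> 'aaa"
    and \<Delta> :: "'a \<Rightarrow> 'aa"
    and tB :: "'b::cstar_algebra \<Rightarrow> 'a \<Rightarrow> 'ba::cstar_algebra"
    and tB_AA :: "'b \<Rightarrow> 'aa \<Rightarrow> 'baa::cstar_algebra"
    and tBA_A :: "'ba \<Rightarrow> 'a \<Rightarrow> 'baa"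
    and \<eta> :: "'b \<Rightarrow> 'ba"
    and u :: "'a ^ 'n ^ 'n"
    and ubar :: "'a ^ 'm ^ 'm"
    and R :: "complex ^ 1 \<Rightarrow> complex ^ ('m \<times> 'n)"
    and Rbar :: "complex ^ 1 \<Rightarrow> complex ^ ('n \<times> 'm)"
    and j :: "complex ^ 'n \<Rightarrow> complex ^ 'm"
  assumes "nondegenerate_ergodic_action tA tA_AA tAA_A \<Delta> tB tB_AA tBA_A \<eta>"
    and "unitary_rep tA \<Delta> u" and "irreducible_rep u"
    and "unitary_rep tA \<Delta> ubar"
    and "R \<in> arrows trivial_rep (rep_tens ubar u)"
    and "Rbar \<in> arrows trivial_rep (rep_tens u ubar)"
    and "conjugate_equations R Rbar"
    and "antilinear j" and "bij j"
    and "R (stdb 1) = (\<Sum>i\<in>UNIV. vtens (j (stdb i)) (stdb i))"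
  shows "let Lu = Lbar tB \<eta> u; Lubar = Lbar tB \<eta> ubar; J = J_bar j;
      Rh = R_hat tB \<eta> ubar u R; Rbarh = R_hat tB \<eta> u ubar Rbar in
    (\<forall>E. orthonormal_basis Lu E \<longrightarrow> Rh = (\<Sum>T\<in>E. tens Lubar Lu (J T) T)) \<and>
    (\<forall>F. orthonormal_basis Lubar F \<longrightarrow>
       Rbarh = (\<Sum>S\<in>F. tens Lu Lubar (inv_into (hcarrier Lu) J S) S)) \<and>
    q_mult Lu Lubar J = d_hat (tens_space Lubar Lu) Rh (tens_space Lu Lubar) Rbarh"
proof -
  interpret nondegenerate_ergodic_action tA tA_AA tAA_A \<Delta> tB tB_AA tBA_A \<eta> by fact
  define i where "i = inv j"
  have ij: "i (j x) = x" and ji: "j (i y) = y" for x y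
    using assms(9) by (simp_all add: i_def bij_is_inj bij_is_surj surj_f_inv_f)
  have i: "antilinear i" unfolding i_def by (rule antilinear_inv[OF assms(8,9)])
  have u: "unitary_matrix u" and v: "unitary_matrix ubar"
    using assms(2,4) unitary_rep_unitary_matrix by blast+
  \<comment> \<open>From here on the barred data have the same form as the original ones, with
    \<open>i\<close> for \<open>j\<close>.\<close>
  have Rbar: "Rbar (stdb 1) = (\<Sum>k\<in>UNIV. vtens (i (stdb k)) (stdb k))"
    unfolding i_def using assms(7-10) arrow_trivial(1)[OF assms(6)]
    by (intro conjugate_of_inverse[where R = R]) (simp_all add: conjugate_equations_def)
  have C: "conjugation u ubar j R" using assms(5,8,10) u v by (simp add: conjugation_def)
  have C': "conjugation ubar u i Rbar" using assms(6) Rbar i u v by (simp add: conjugation_def)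
  interpret U: inner_product_space "L u" by (rule L_inner_product_space[OF u])
  interpret V: inner_product_space "L ubar" by (rule L_inner_product_space[OF v])
  interpret UV: inner_product_space_pair "L u" "L ubar" ..
  interpret VU: inner_product_space_pair "L ubar" "L u" ..
  note Jcar = J_bar_carrier[OF C] and Icar = J_bar_carrier[OF C']
  note IJ = J_bar_inverse[OF assms(8) i ij] and JI = J_bar_inverse[OF i assms(8) ji]
  obtain E where E: "orthonormal_basis (L u) E" using L_finite_dimensional[OF C C' ij] by blast
  have exF: "\<exists>F. orthonormal_basis (L ubar) F" by (rule L_finite_dimensional[OF C' C ji])
  \<comment> \<open>The same choice as in \<open>q_mult_eq\<close>, whereas \<open>E\<close> may be
    any basis.\<close>
  define F where "F = (SOME F. orthonormal_basis (L ubar) F)"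
  have F: "orthonormal_basis (L ubar) F" unfolding F_def using exF by (rule someI_ex)
  have inj: "inj_on (J_bar j) (hcarrier (L u))" by (rule inj_on_inverseI) (rule IJ)
  \<comment> \<open>Restricted to the carriers, inverting \<open>J_bar j\<close> amounts to
    inverting \<open>j\<close> first.\<close>
  have inv: "inv_into (hcarrier (L u)) (J_bar j) S = J_bar i S" if "S \<in> hcarrier (L ubar)" for S
    by (rule inv_into_f_eq[OF inj Icar[OF that] JI])
  have Rh: "R_hat tB \<eta> ubar u R = (\<Sum>T\<in>E'. tens (L ubar) (L u) (J_bar j T) T)"
    if "orthonormal_basis (L u) E'" for E' by (rule R_hat_eq[OF C that F])
  have Rbarh: "R_hat tB \<eta> u ubar Rbar = (\<Sum>S\<in>F'. tens (L u) (L ubar) (J_bar i S) S)"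
    if "orthonormal_basis (L ubar) F'" for F' by (rule R_hat_eq[OF C' that E])
  have "q_mult (L u) (L ubar) (J_bar j) = sqrt (Re ((\<Sum>e\<in>E. hinner (L ubar) (J_bar j e) (J_bar j e))
      * (\<Sum>f\<in>F. hinner (L u) (J_bar i f) (J_bar i f))))"
    unfolding F_def
    by (rule UV.q_mult_eq[OF E exF antilinear_J_bar _ antilinear_J_bar]) (use Jcar Icar IJ JI in auto)
  also have "(\<Sum>e\<in>E. hinner (L ubar) (J_bar j e) (J_bar j e))
      = hinner (tens_space (L ubar) (L u)) (R_hat tB \<eta> ubar u R) (R_hat tB \<eta> ubar u R)" (is "?a = ?a'")
    unfolding Rh[OF E]
    by (rule VU.inner_sum_tens_self[OF E Jcar[OF U.onb_carrier[OF E]], symmetric])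
  also have "(\<Sum>f\<in>F. hinner (L u) (J_bar i f) (J_bar i f))
      = hinner (tens_space (L u) (L ubar)) (R_hat tB \<eta> u ubar Rbar) (R_hat tB \<eta> u ubar Rbar)" (is "?b = ?b'")
    unfolding Rbarh[OF F]
    by (rule UV.inner_sum_tens_self[OF F Icar[OF V.onb_carrier[OF F]], symmetric])
  \<comment> \<open>\<open>q_mult\<close> takes the real part of a product, \<open>d_hat\<close> a
    product of real parts; they agree since the first factor is real.\<close>
  also have "Re (?a' * ?b') = Re ?a' * Re ?b'"
  proof -
    have "cnj ?a = ?a"
      by (simp add: cnj_sum V.inner_commute[symmetric] Jcar U.onb_carrier[OF E])
    then have "Im ?a = 0" by (simp only: complex_eq_iff cnj.simps neg_equal_zero)
    then have "Im ?a' = 0" by (simp only: \<open>?a = ?a'\<close>)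
    then show ?thesis by (simp only: times_complex.simps mult_zero_left diff_zero)
  qed
  finally have q: "q_mult (L u) (L ubar) (J_bar j) = d_hat (tens_space (L ubar) (L u)) (R_hat tB \<eta> ubar u R)
      (tens_space (L u) (L ubar)) (R_hat tB \<eta> u ubar Rbar)"
    by (simp add: d_hat_def hnorm_def real_sqrt_mult)
  have Rbarh_inv: "R_hat tB \<eta> u ubar Rbar
      = (\<Sum>S\<in>F'. tens (L u) (L ubar) (inv_into (hcarrier (L u)) (J_bar j) S) S)"
    if "orthonormal_basis (L ubar) F'" for F'
    unfolding Rbarh[OF that] by (intro sum.cong refl) (simp add: inv V.onb_carrier[OF that])
  show ?thesis
    unfolding Let_def by (intro conjI allI impI; rule Rh Rbarh_inv q) assumption+
qed

end
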